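(* There exist constants $c_1, c_2>0$ and a positive integer $w_0$ such that for every odd integer $w\ge w_0$, $$c_1\, w^{1/3}\le \log \kappa^{\ast}(2,w)\le c_2\, w^{1/3},$$ where $\kappa^\ast(2,w)$ is the number of equivalence classes of two-dimensional centrally symmetric convex lattice polygons containing exactly $w$ lattice points.
   Context: A convex lattice polytope in $\mathbb{E}^d$ is the convex hull of a finite subset of the integer lattice $\mathbb{Z}^d$; it is called $d$-dimensional if it has non-empty interior (a polygon when $d=2$). Let $|P|$ denote the cardinality of $P\cap\mathbb{Z}^d$. Two $d$-dimensional convex lattice polytopes $P_1,P_2$ are equivalent if there is an affine transformation $\sigma$ of $\mathbb{E}^d$ with $\sigma(\mathbb{Z}^d)=\mathbb{Z}^d$ and $\sigma(P_1)=P_2$. Centrally symmetric means symmetric about a lattice point (equivalently, up to a lattice translation, $P=-P$). $\kappa^\ast(d,w)$ denotes the number of equivalence classes of $d$-dimensional centrally symmetric convex lattice polytopes $P$ with $|P|=w$. *)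

theory Defs
  imports "HOL-Analysis.Analysis"
begin

definition int_lattice :: "(real ^ 'n) set" where
  "int_lattice = {x. \<forall>i. x $ i \<in> \<int>}"

definition lattice_polytope :: "(real ^ 'n) set \<Rightarrow> bool" where
  "lattice_polytope P \<longleftrightarrow> (\<exists>V. finite V \<and> V \<subseteq> int_lattice \<and> P = convex hull V)"

definition lattice_point_count :: "(real ^ 'n) set \<Rightarrow> nat" where
  "lattice_point_count P = card (P \<inter> int_lattice)"

definition centrally_symmetric :: "(real ^ 'n) set \<Rightarrow> bool" where
  "centrally_symmetric P \<longleftrightarrow> (\<exists>c \<in> int_lattice. (\<lambda>x. 2 *\<^sub>R c - x) ` P = P)"

definition affine_transformation :: "(real ^ 'n \<Rightarrow> real ^ 'n) \<Rightarrow> bool" where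
  "affine_transformation \<sigma> \<longleftrightarrow> (\<exists>A b. invertible A \<and> \<sigma> = (\<lambda>x. A *v x + b))"

definition lattice_equivalent :: "(real ^ 'n) set \<Rightarrow> (real ^ 'n) set \<Rightarrow> bool" where
  "lattice_equivalent P Q \<longleftrightarrow>
     (\<exists>\<sigma>. affine_transformation \<sigma> \<and> \<sigma> ` int_lattice = int_lattice \<and> \<sigma> ` P = Q)"

definition symmetric_polytopes :: "nat \<Rightarrow> (real ^ 'n) set set" where
  "symmetric_polytopes w =
     {P. lattice_polytope P \<and> interior P \<noteq> {} \<and> centrally_symmetric P \<and>
         lattice_point_count P = w}"

text \<open>The dimension \<open>d\<close> is passed as an index type with \<open>d\<close> elements, so that
  \<open>\<kappa>\<^sup>*(2, w)\<close> is \<open>kappa_star TYPE(2) w\<close>.\<close>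

definition kappa_star :: "'n::finite itself \<Rightarrow> nat \<Rightarrow> nat" where
  "kappa_star _ w =
     card ((symmetric_polytopes w :: (real ^ 'n) set set) //
           {(P, Q). P \<in> symmetric_polytopes w \<and> Q \<in> symmetric_polytopes w \<and>
                    lattice_equivalent P Q})"

lemma lattice_equivalent_refl:
  fixes P :: "(real ^ 'n) set"
  shows "lattice_equivalent P P"
  unfolding lattice_equivalent_def affine_transformation_def
proof (intro exI conjI)
  show "invertible (mat 1 :: real ^ 'n ^ 'n)"
    unfolding invertible_def by (rule exI[of _ "mat 1"]) simp
  show "(\<lambda>x. x) = (\<lambda>x. (mat 1 :: real ^ 'n ^ 'n) *v x + 0)"
    by simp
qed simp_all

lemma lattice_equivalent_sym:
  assumes "lattice_equivalent P Q"
  shows "lattice_equivalent Q P"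
proof -
  obtain A b where A: "invertible A"
    and L: "(\<lambda>x. A *v x + b) ` int_lattice = int_lattice"
    and Q: "(\<lambda>x. A *v x + b) ` P = Q"
    using assms unfolding lattice_equivalent_def affine_transformation_def by blast
  obtain B where B: "A ** B = mat 1" "B ** A = mat 1"
    using A unfolding invertible_def by blast
  define \<tau> where "\<tau> = (\<lambda>x. B *v x + (- (B *v b)))"
  have inv: "\<tau> (A *v x + b) = x" for x
    by (simp add: \<tau>_def matrix_vector_right_distrib matrix_vector_mul_assoc B)
  have aff: "affine_transformation \<tau>"
    unfolding affine_transformation_def \<tau>_def using B invertible_def by blast
  have lat: "\<tau> ` int_lattice = int_lattice"
    by (subst L[symmetric]) (simp add: image_image inv)
  have im: "\<tau> ` Q = P"
    by (subst Q[symmetric]) (simp add: image_image inv)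
  show ?thesis
    unfolding lattice_equivalent_def using aff lat im by blast
qed

lemma lattice_equivalent_trans:
  assumes "lattice_equivalent P Q" "lattice_equivalent Q R"
  shows "lattice_equivalent P R"
proof -
  obtain A b where A: "invertible A"
    and L: "(\<lambda>x. A *v x + b) ` int_lattice = int_lattice"
    and Q: "(\<lambda>x. A *v x + b) ` P = Q"
    using assms(1) unfolding lattice_equivalent_def affine_transformation_def by blast
  obtain B c where B: "invertible B"
    and L': "(\<lambda>x. B *v x + c) ` int_lattice = int_lattice"
    and R: "(\<lambda>x. B *v x + c) ` Q = R"
    using assms(2) unfolding lattice_equivalent_def affine_transformation_def by blast
  define \<tau> where "\<tau> = (\<lambda>x. (B ** A) *v x + (B *v b + c))"
  have comp: "\<tau> x = B *v (A *v x + b) + c" for x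
    by (simp add: \<tau>_def matrix_vector_right_distrib matrix_vector_mul_assoc)
  have aff: "affine_transformation \<tau>"
    unfolding affine_transformation_def \<tau>_def using invertible_mult[OF B A] by blast
  have lat: "\<tau> ` int_lattice = int_lattice"
    by (subst L'[symmetric], subst L[symmetric]) (simp add: image_image comp)
  have im: "\<tau> ` P = R"
    by (simp add: R[symmetric] Q[symmetric] image_image comp)
  show ?thesis
    unfolding lattice_equivalent_def using aff lat im by blast
qed

lemma equiv_lattice_equivalent:
  "equiv S {(P, Q). P \<in> S \<and> Q \<in> S \<and> lattice_equivalent P Q}"
  by (rule equivI)
     (auto simp: refl_on_def sym_def trans_def
       intro: lattice_equivalent_refl lattice_equivalent_sym lattice_equivalent_trans)

end

theory Submission
  imports Defs "HOL-Real_Asymp.Real_Asymp"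
begin

text \<open>Upper bound. Centre \<open>P\<close> at \<open>0\<close> and let \<open>k\<close> be maximal such that \<open>k v \<in> P\<close> for some lattice
  vector \<open>v \<noteq> 0\<close>. Pigeonhole modulo \<open>2 (k + 1)\<close> gives \<open>w \<le> 4 (k + 1)\<^sup>2\<close>, and after a unimodular map
  with \<open>v = (1, 0)\<close> the polygon lies in a box \<open>[- 36 k, 36 k] \<times> [- b, b]\<close> with \<open>k b \<le> 2 w\<close>. A symmetric
  polygon is determined by the leftmost point of its upper boundary and the set of its upper edges.
  Such edge sets have bounded total width and height, and counting them with exponential weights
  gives at most \<open>exp (O ((k b) powr (1/3)))\<close> of them.

  Lower bound. Take \<open>n\<close> of order \<open>w powr (1/3)\<close>. The region between the parabola \<open>y = H - x\<^sup>2\<close>,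
  \<open>\<bar>x\<bar> \<le> n\<close>, and its point reflection stays lattice-convex when the upper boundary is lowered by \<open>1\<close>
  over any subset of \<open>{1..<n}\<close>. Choosing \<open>H\<close> and lowering the end point \<open>x = n\<close> by a suitable amount makes
  the number of lattice points equal to \<open>w\<close>. So there are \<open>2 ^ (n - 1)\<close> such polygons, and at most
  \<open>w\<^sup>3\<close> of them are in one class.\<close>

section \<open>Lattice points as integer pairs\<close>

definition pt :: "int \<times> int \<Rightarrow> real ^ 2" where
  "pt z = vector [of_int (fst z), of_int (snd z)]"

definition lat :: "(real ^ 2) set \<Rightarrow> (int \<times> int) set" where
  "lat P = {z. pt z \<in> P}"

lemma pt_nth [simp]: "pt z $ 1 = of_int (fst z)" "pt z $ 2 = of_int (snd z)"
  by (simp_all add: pt_def)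

lemma vec2_eq_iff: "x = y \<longleftrightarrow> x $ 1 = y $ 1 \<and> x $ 2 = (y :: real ^ 2) $ 2"
  by (simp add: vec_eq_iff forall_2)

lemma inner_vec2: "x \<bullet> y = x $ 1 * y $ 1 + x $ 2 * (y :: real ^ 2) $ 2"
  by (simp add: inner_vec_def sum_2)

lemma inj_pt: "inj pt"
  by (auto intro!: injI simp: vec2_eq_iff prod_eq_iff)

lemma pt_zero [simp]: "pt (0, 0) = 0" "pt 0 = 0"
  by (simp_all add: vec2_eq_iff)

lemma pt_add: "pt (z + z') = pt z + pt z'"
  and pt_diff: "pt (z - z') = pt z - pt z'"
  and pt_minus: "pt (- z) = - pt z"
  by (simp_all add: vec2_eq_iff)

lemma range_pt: "range pt = int_lattice"
proof
  show "range pt \<subseteq> int_lattice"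
    by (auto simp: int_lattice_def forall_2)
  show "int_lattice \<subseteq> range pt"
  proof
    fix x :: "real ^ 2"
    assume "x \<in> int_lattice"
    then obtain a b where "x $ 1 = of_int a" "x $ 2 = of_int b"
      by (auto simp: int_lattice_def forall_2 elim!: Ints_cases)
    then have "x = pt (a, b)"
      by (simp add: vec2_eq_iff)
    then show "x \<in> range pt" by blast
  qed
qed

lemma pt_lat: "pt ` lat P = P \<inter> int_lattice"
  unfolding range_pt[symmetric] lat_def by auto

lemma lattice_point_count_lat: "lattice_point_count P = card (lat P)"
  unfolding lattice_point_count_def pt_lat[symmetric]
  by (rule card_image) (rule inj_on_subset[OF inj_pt], simp)

lemma finite_lat:
  assumes "bounded P"
  shows "finite (lat P)"
proof -
  obtain B where B: "\<And>x. x \<in> P \<Longrightarrow> norm x \<le> B"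
    using assms unfolding bounded_iff by blast
  have "lat P \<subseteq> {-\<lceil>B\<rceil>..\<lceil>B\<rceil>} \<times> {-\<lceil>B\<rceil>..\<lceil>B\<rceil>}"
  proof
    fix z assume "z \<in> lat P"
    then have "norm (pt z) \<le> B" by (simp add: B lat_def)
    then have "\<bar>pt z $ 1\<bar> \<le> B" "\<bar>pt z $ 2\<bar> \<le> B"
      by (meson component_le_norm_cart order_trans)+
    then have "\<bar>fst z\<bar> \<le> \<lceil>B\<rceil>" "\<bar>snd z\<bar> \<le> \<lceil>B\<rceil>"
      by (simp_all, linarith+)
    then show "z \<in> {-\<lceil>B\<rceil>..\<lceil>B\<rceil>} \<times> {-\<lceil>B\<rceil>..\<lceil>B\<rceil>}"
      by (cases z) auto
  qed
  then show ?thesis by (rule finite_subset) simp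
qed

lemma bounded_lattice_polytope: "lattice_polytope P \<Longrightarrow> bounded P"
  unfolding lattice_polytope_def by (auto simp: finite_imp_bounded bounded_convex_hull)

text \<open>Every generating point is itself a lattice point of \<open>P\<close>, so
  \<open>lat P\<close> already contains enough to span the polytope.\<close>

lemma lattice_polytope_eq_hull:
  assumes "lattice_polytope P"
  shows "P = convex hull (pt ` lat P)"
proof -
  obtain V where V: "finite V" "V \<subseteq> int_lattice" "P = convex hull V"
    using assms unfolding lattice_polytope_def by blast
  have "V \<subseteq> pt ` lat P"
    unfolding pt_lat using V hull_subset[of V convex] by auto
  then have "P \<subseteq> convex hull (pt ` lat P)"
    unfolding V(3) by (rule hull_mono)
  moreover have "convex hull (pt ` lat P) \<subseteq> P"
    by (rule hull_minimal) (auto simp: lat_def V)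
  ultimately show ?thesis by blast
qed

lemma lattice_polytope_hull: "finite V \<Longrightarrow> lattice_polytope (convex hull (pt ` V))"
  unfolding lattice_polytope_def range_pt[symmetric]
  by (rule exI[of _ "pt ` V"]) auto

text \<open>A point of \<open>V\<close> outside the compact hull of \<open>W\<close> would be
  strictly separated from it by some \<open>a\<close>; the comparison in direction
  \<open>- a\<close> forbids this.\<close>

lemma support_imp_hull_subset:
  fixes V W :: "'a::euclidean_space set"
  assumes "finite W" and "\<And>u v. v \<in> V \<Longrightarrow> \<exists>w\<in>W. u \<bullet> v \<le> u \<bullet> w"
  shows "convex hull V \<subseteq> convex hull W"
proof (rule hull_minimal)
  show "V \<subseteq> convex hull W"
  proof (rule subsetI, rule ccontr)
    fix v assume v: "v \<in> V" "v \<notin> convex hull W"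
    have "closed (convex hull W)"
      using assms(1) by (simp add: compact_imp_closed finite_imp_compact_convex_hull)
    then obtain a b where ab: "a \<bullet> v < b" "\<forall>x\<in>convex hull W. a \<bullet> x > b"
      using separating_hyperplane_closed_point[OF convex_convex_hull _ v(2)] by blast
    obtain w where "w \<in> W" "(- a) \<bullet> v \<le> (- a) \<bullet> w"
      using assms(2)[OF v(1)] by blast
    then show False
      using ab hull_subset[of W convex] by force
  qed
qed simp

subsection \<open>Upper boundaries\<close>

text \<open>Inner product with the upward direction \<open>(- s, 1)\<close>. Up to a positive
  factor, every direction with positive second coordinate has this form.\<close>

abbreviation ht :: "real \<Rightarrow> int \<times> int \<Rightarrow> real" where
  "ht s z \<equiv> real_of_int (snd z) - s * real_of_int (fst z)"

text \<open>The edges of the upper boundary of \<open>V\<close>, walked from its highest leftmost point \<open>p\<close>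
  by gift wrapping. They recover the support function of \<open>V\<close> in all upward
  directions.\<close>

lemma upper_chain_from:
  fixes V :: "(int \<times> int) set"
  assumes "finite V" "p \<in> V"
    and "\<forall>r\<in>V. fst p < fst r \<or> fst r = fst p \<and> snd r \<le> snd p"
  shows "\<exists>E. finite E \<and> (\<forall>e\<in>E. fst e > 0) \<and> p + \<Sum>E \<in> V \<and>
     (\<forall>e\<in>E. \<forall>f\<in>E. snd e = 0 \<longrightarrow> snd f = 0 \<longrightarrow> e = f) \<and>
     (\<forall>e\<in>E. \<exists>r\<in>V. fst p < fst r \<and>
        real_of_int (snd e) / real_of_int (fst e) \<le>
        real_of_int (snd r - snd p) / real_of_int (fst r - fst p)) \<and>
     (\<forall>s::real. let H = ht s p + (\<Sum>e\<in>E. max 0 (ht s e)) in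
        (\<forall>r\<in>V. ht s r \<le> H) \<and> (\<exists>r\<in>V. ht s r = H))"
  using assms
proof (induction "card V" arbitrary: V p rule: less_induct)
  case less
  define R where "R = {r \<in> V. fst p < fst r}"
  show ?case
  proof (cases "R = {}")
    case True
    then have r: "fst r = fst p \<and> snd r \<le> snd p" if "r \<in> V" for r
    proof -
      have "r \<notin> R" using True by blast
      then show ?thesis using bspec[OF less.prems(3) that] that unfolding R_def by blast
    qed
    have "ht s r \<le> ht s p" if "r \<in> V" for r s
      using r[OF that] by (metis diff_right_mono of_int_le_iff)
    then show ?thesis
      by (intro exI[of _ "{}"]) (use less.prems(2) in \<open>auto simp: Let_def\<close>)
  next
    case False
    define m where "m = (\<lambda>r. real_of_int (snd r - snd p) / real_of_int (fst r - fst p))"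
    have finR: "finite R" using less.prems(1) by (simp add: R_def)
    \<comment> \<open>\<open>M\<close> is the steepest slope seen from \<open>p\<close>. Among the
      points attaining it, the farthest one, \<open>q\<close>, is the next vertex, so that all later
      slopes are strictly smaller.\<close>
    define M where "M = Max (m ` R)"
    have M_ge: "m r \<le> M" if "r \<in> R" for r
      using that finR by (simp add: M_def)
    define Q where "Q = {r \<in> R. m r = M}"
    have "M \<in> m ` R" unfolding M_def using finR False by (intro Max_in) auto
    then have "Q \<noteq> {}" unfolding Q_def by auto
    moreover have finQ: "finite Q" using finR by (simp add: Q_def)
    ultimately have "Max (fst ` Q) \<in> fst ` Q" by (intro Max_in) auto
    then obtain q where q: "q \<in> Q" "fst q = Max (fst ` Q)" by auto
    have q_far: "fst r \<le> fst q" if "r \<in> Q" for r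
      using that finQ q(2) by simp
    have qR: "q \<in> R" "q \<in> V" "fst p < fst q" "m q = M"
      using q(1) by (auto simp: Q_def R_def)
    have qM: "real_of_int (snd q) - real_of_int (snd p) = M * (real_of_int (fst q) - real_of_int (fst p))"
      using qR(3) unfolding qR(4)[symmetric] m_def by simp
    have below: "real_of_int (snd r) - real_of_int (snd p) \<le> M * (real_of_int (fst r) - real_of_int (fst p))"
      if "r \<in> V" for r
    proof (cases "fst p < fst r")
      case True
      then have "m r \<le> M" using that by (intro M_ge) (simp add: R_def)
      then show ?thesis using True by (simp add: m_def pos_divide_le_eq)
    next
      case False
      then show ?thesis using bspec[OF less.prems(3) that] by auto
    qed
    have strict: "real_of_int (snd r) - real_of_int (snd p) < M * (real_of_int (fst r) - real_of_int (fst p))"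
      if "r \<in> V" "fst q < fst r" for r
    proof (rule ccontr)
      assume "\<not> ?thesis"
      then have "real_of_int (snd r) - real_of_int (snd p) = M * (real_of_int (fst r) - real_of_int (fst p))"
        using below[OF that(1)] by simp
      then have "m r = M" using that(2) qR(3) by (simp add: m_def)
      then have "r \<in> Q" using that qR(3) by (simp add: Q_def R_def)
      then show False using q_far[of r] that(2) by simp
    qed
    define V' where "V' = {r \<in> V. fst q \<le> fst r}"
    have V': "finite V'" "q \<in> V'" "V' \<subseteq> V" "p \<notin> V'"
      using less.prems(1) qR by (auto simp: V'_def)
    then have smaller: "card V' < card V"
      using less.prems(1,2) by (intro psubset_card_mono) auto
    have "fst q < fst r \<or> fst r = fst q \<and> snd r \<le> snd q" if "r \<in> V'" for r
    proof (cases "fst r = fst q")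
      case True
      then have "real_of_int (snd r) \<le> snd q"
        using below[of r] that qM by (simp add: V'_def)
      with True show ?thesis by simp
    qed (use that in \<open>auto simp: V'_def\<close>)
    then have "\<forall>r\<in>V'. fst q < fst r \<or> fst r = fst q \<and> snd r \<le> snd q" by blast
    note less.hyps[OF smaller V'(1,2) this]
    then obtain E' where E': "finite E'" "\<forall>e\<in>E'. fst e > 0" "q + \<Sum>E' \<in> V'"
      "\<forall>e\<in>E'. \<forall>f\<in>E'. snd e = 0 \<longrightarrow> snd f = 0 \<longrightarrow> e = f"
      and sl: "\<forall>e\<in>E'. \<exists>r\<in>V'. fst q < fst r \<and>
        real_of_int (snd e) / real_of_int (fst e) \<le>
        real_of_int (snd r - snd q) / real_of_int (fst r - fst q)"
      and H: "\<forall>s::real. let H = ht s q + (\<Sum>e\<in>E'. max 0 (ht s e)) in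
        (\<forall>r\<in>V'. ht s r \<le> H) \<and> (\<exists>r\<in>V'. ht s r = H)"
      by (elim exE conjE) (rule that)
    \<comment> \<open>Here the slope clause of the induction hypothesis is used: a later edge is no
      steeper than some chord starting at \<open>q\<close>, and such chords have slope below
      \<open>M\<close>.\<close>
    have slope: "real_of_int (snd e) / real_of_int (fst e) < M" if e: "e \<in> E'" for e
    proof -
      obtain r where r: "r \<in> V'" "fst q < fst r"
        "real_of_int (snd e) / real_of_int (fst e) \<le>
         real_of_int (snd r - snd q) / real_of_int (fst r - fst q)"
        using bspec[OF sl e] by blast
      have "real_of_int (snd r) - real_of_int (snd q) < M * (real_of_int (fst r) - real_of_int (fst q))"
        using strict[OF subsetD[OF V'(3) r(1)] r(2)] qM by (simp add: algebra_simps)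
      then have "real_of_int (snd r - snd q) / real_of_int (fst r - fst q) < M"
        using r(2) by (simp add: pos_divide_less_eq)
      with r(3) show ?thesis by simp
    qed
    define d where "d = q - p"
    have d: "fst d > 0" "real_of_int (snd d) / real_of_int (fst d) = M" "p + d = q"
      using qR unfolding d_def m_def by auto
    have dM: "real_of_int (snd d) = M * real_of_int (fst d)"
      using d by auto
    have dE: "d \<notin> E'" using slope d(2) by force
    define E where "E = insert d E'"
    have sumE: "p + \<Sum>E = q + \<Sum>E'"
      unfolding E_def using E'(1) dE d(3) by (simp add: add.assoc[symmetric])
    \<comment> \<open>For \<open>s \<ge> M\<close> the point \<open>p\<close> is highest and no edge
      contributes. For \<open>s < M\<close> the edge \<open>d\<close> contributes its full height,
      and no point left of \<open>q\<close> rises above \<open>q\<close>.\<close>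
    have chain: "(let H = ht s p + (\<Sum>e\<in>E. max 0 (ht s e)) in
        (\<forall>r\<in>V. ht s r \<le> H) \<and> (\<exists>r\<in>V. ht s r = H))" for s :: real
    proof (cases "M \<le> s")
      case True
      have "max 0 (ht s e) = 0" if "e \<in> E" for e
      proof -
        have "fst e > 0" "real_of_int (snd e) / real_of_int (fst e) \<le> M"
          using that slope[of e] d E'(2) by (auto simp: E_def)
        then have "real_of_int (snd e) \<le> M * real_of_int (fst e)" "M * real_of_int (fst e) \<le> s * real_of_int (fst e)"
          using True by (simp_all add: pos_divide_le_eq mult_right_mono)
        then show ?thesis by simp
      qed
      then have "(\<Sum>e\<in>E. max 0 (ht s e)) = 0" by simp
      moreover have "ht s r \<le> ht s p" if "r \<in> V" for r
      proof -
        have "0 \<le> real_of_int (fst r) - real_of_int (fst p)"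
          using bspec[OF less.prems(3) that] by auto
        then have "M * (real_of_int (fst r) - real_of_int (fst p)) \<le> s * (real_of_int (fst r) - real_of_int (fst p))"
          using True by (simp add: mult_right_mono)
        then show ?thesis using below[OF that] by (simp add: algebra_simps)
      qed
      ultimately show ?thesis using less.prems(2) by (auto simp: Let_def)
    next
      case False
      define h where "h = ht s q + (\<Sum>e\<in>E'. max 0 (ht s e))"
      have h: "\<forall>r\<in>V'. ht s r \<le> h" "\<exists>r\<in>V'. ht s r = h"
        using H unfolding h_def Let_def by blast+
      have "s * real_of_int (fst d) \<le> M * real_of_int (fst d)" using False d(1) by (simp add: mult_right_mono)
      then have "max 0 (ht s d) = ht s d"
        using dM by simp
      then have "ht s p + (\<Sum>e\<in>E. max 0 (ht s e)) = h"
        unfolding E_def h_def using E'(1) dE d(3)[symmetric] by (simp add: algebra_simps)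
      moreover have "ht s r \<le> h" if "r \<in> V" for r
      proof (cases "r \<in> V'")
        case False
        then have "fst r \<le> fst q" using that by (simp add: V'_def)
        then have "(M - s) * (real_of_int (fst r) - real_of_int (fst q)) \<le> 0"
          using \<open>\<not> M \<le> s\<close> by (simp add: mult_nonneg_nonpos)
        then have "ht s r \<le> ht s q"
          using below[OF that] qM by (simp add: algebra_simps)
        then show ?thesis using h(1) V'(2) by fastforce
      qed (use h in auto)
      ultimately show ?thesis using h(2) V'(3) by (auto simp: Let_def)
    qed
    have slopes: "\<forall>e\<in>E. \<exists>r\<in>V. fst p < fst r \<and> real_of_int (snd e) / real_of_int (fst e) \<le>
        real_of_int (snd r - snd p) / real_of_int (fst r - fst p)"
    proof
      fix e assume "e \<in> E"
      then have "real_of_int (snd e) / real_of_int (fst e) \<le> m q"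
        using slope[of e] d(2) qR(4) by (auto simp: E_def)
      then show "\<exists>r\<in>V. fst p < fst r \<and> real_of_int (snd e) / real_of_int (fst e) \<le>
        real_of_int (snd r - snd p) / real_of_int (fst r - fst p)"
        using qR(2,3) unfolding m_def by blast
    qed
    \<comment> \<open>Slopes decrease strictly, so slope 0 occurs at most once.\<close>
    have "e = f" if ef: "e \<in> E" "f \<in> E" "snd e = 0" "snd f = 0" for e f
    proof -
      have "M > 0" if "g \<in> E'" "snd g = 0" for g
        using slope[OF that(1)] that(2) by simp
      moreover have "M = 0" if "snd d = 0"
        using d(2) that by simp
      ultimately show ?thesis
        using ef E'(4) unfolding E_def by (metis insert_iff less_irrefl)
    qed
    then have flat: "\<forall>e\<in>E. \<forall>f\<in>E. snd e = 0 \<longrightarrow> snd f = 0 \<longrightarrow> e = f" by blast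
    have "finite E" "\<forall>e\<in>E. fst e > 0" "p + \<Sum>E \<in> V"
      using E'(1-3) d(1) V'(3) unfolding sumE unfolding E_def by auto
    then show ?thesis
      by (intro exI[of _ E] conjI allI) (assumption | rule flat slopes chain)+
  qed
qed


text \<open>\<open>H\<close> is the support function of \<open>V\<close> in direction
  \<open>(- s, 1)\<close>: edges steeper than \<open>s\<close> climb, the others add 0. Being a sum
  over \<open>E\<close>, it does not depend on the order of the edges.\<close>

definition upper_chain :: "(int \<times> int) set \<Rightarrow> int \<times> int \<Rightarrow> (int \<times> int) set \<Rightarrow> bool" where
  "upper_chain V p E \<longleftrightarrow> p \<in> V \<and> (\<forall>r\<in>V. fst p \<le> fst r) \<and> finite E \<and> (\<forall>e\<in>E. fst e > 0) \<and>
     p + \<Sum>E \<in> V \<and> (\<forall>e\<in>E. \<forall>f\<in>E. snd e = 0 \<longrightarrow> snd f = 0 \<longrightarrow> e = f) \<and>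
     (\<forall>s::real. let H = ht s p + (\<Sum>e\<in>E. max 0 (ht s e)) in
        (\<forall>r\<in>V. ht s r \<le> H) \<and> (\<exists>r\<in>V. ht s r = H))"

lemma upper_chain_ht:
  assumes "upper_chain V p E"
  shows "r \<in> V \<Longrightarrow> ht s r \<le> ht s p + (\<Sum>e\<in>E. max 0 (ht s e))"
    and "\<exists>r\<in>V. ht s r = ht s p + (\<Sum>e\<in>E. max 0 (ht s e))"
proof -
  have "\<forall>s::real. let H = ht s p + (\<Sum>e\<in>E. max 0 (ht s e)) in
        (\<forall>r\<in>V. ht s r \<le> H) \<and> (\<exists>r\<in>V. ht s r = H)"
    using assms unfolding upper_chain_def by (elim conjE)
  from spec[OF this, of s]
  show "r \<in> V \<Longrightarrow> ht s r \<le> ht s p + (\<Sum>e\<in>E. max 0 (ht s e))"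
    and "\<exists>r\<in>V. ht s r = ht s p + (\<Sum>e\<in>E. max 0 (ht s e))"
    unfolding Let_def by (blast, elim conjE)
qed

lemma upper_chain_exists:
  assumes "finite V" "V \<noteq> {}"
  shows "\<exists>p E. upper_chain V p E"
proof -
  define L where "L = {r \<in> V. fst r = Min (fst ` V)}"
  have "Min (fst ` V) \<in> fst ` V" using assms by (intro Min_in) auto
  then have "L \<noteq> {}" by (auto simp: L_def)
  moreover have "finite L" using assms by (simp add: L_def)
  ultimately have "Max (snd ` L) \<in> snd ` L" by (intro Max_in) auto
  then obtain p where p: "p \<in> L" "snd p = Max (snd ` L)" by auto
  have left: "fst p < fst r \<or> fst r = fst p \<and> snd r \<le> snd p" if "r \<in> V" for r
  proof (cases "r \<in> L")
    case True
    then show ?thesis using p \<open>finite L\<close> by (simp add: L_def)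
  next
    case False
    then have "fst p \<noteq> fst r" using that p by (simp add: L_def)
    moreover have "fst p \<le> fst r" using that p assms by (simp add: L_def)
    ultimately show ?thesis by simp
  qed
  then have "\<forall>r\<in>V. fst p < fst r \<or> fst r = fst p \<and> snd r \<le> snd p" by blast
  moreover have "p \<in> V" using p by (simp add: L_def)
  moreover have "\<forall>r\<in>V. fst p \<le> fst r" using left by force
  moreover note upper_chain_from[OF assms(1) calculation(2,1)]
  ultimately show ?thesis
    unfolding upper_chain_def by (elim exE conjE) (intro exI conjI)
qed

text \<open>The same start and edges give the same support function in upward directions. Central
  symmetry reduces downward directions to these; in horizontal directions the extreme points are
  \<open>p\<close> and \<open>- p\<close>.\<close>

lemma upper_chain_hull_subset:
  assumes V: "uminus ` V = V" "upper_chain V p E"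
    and W: "finite W" "uminus ` W = W" "upper_chain W p E"
  shows "convex hull (pt ` V) \<subseteq> convex hull (pt ` W)"
proof (rule support_imp_hull_subset)
  have up: "\<exists>r'\<in>W. u \<bullet> pt r \<le> u \<bullet> pt r'" if "r \<in> V" "u $ 2 > 0" for u r
  proof -
    define s where "s = - (u $ 1) / u $ 2"
    define H where "H = ht s p + (\<Sum>e\<in>E. max 0 (ht s e))"
    have u: "u \<bullet> pt z = u $ 2 * (ht s z)" for z
      using that(2) by (simp add: inner_vec2 s_def field_simps)
    have "ht s r \<le> H"
      unfolding H_def by (rule upper_chain_ht(1)[OF V(2) that(1)])
    moreover obtain r' where "r' \<in> W" "ht s r' = H"
      using upper_chain_ht(2)[OF W(3)] unfolding H_def by blast
    ultimately show ?thesis using that(2) unfolding u by force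
  qed
  have neg: "- r \<in> V" if "r \<in> V" for r using V(1) that by blast
  have negW: "- r \<in> W" if "r \<in> W" for r using W(2) that by blast
  fix u v :: "real ^ 2" assume "v \<in> pt ` V"
  then obtain r where r: "r \<in> V" "v = pt r" by blast
  consider "u $ 2 > 0" | "u $ 2 < 0" | "u $ 2 = 0" by linarith
  then show "\<exists>w\<in>pt ` W. u \<bullet> v \<le> u \<bullet> w"
  proof cases
    case 1
    then show ?thesis using up[OF r(1)] r(2) by blast
  next
    case 2
    then obtain r' where "r' \<in> W" "(- u) \<bullet> pt (- r) \<le> (- u) \<bullet> pt r'"
      using up[OF neg[OF r(1)], of "- u"] by auto
    then have "u \<bullet> v \<le> u \<bullet> pt (- r')" by (simp add: pt_minus r(2))
    then show ?thesis using negW[OF \<open>r' \<in> W\<close>] by blast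
  next
    case 3
    have p: "fst p \<le> fst r" "fst p \<le> - fst r" "p \<in> W"
      using V(2) W(3) r(1) neg[OF r(1)] unfolding upper_chain_def by auto
    show ?thesis
    proof (cases "u $ 1 \<ge> 0")
      case True
      have "u $ 1 * real_of_int (fst r) \<le> u $ 1 * - real_of_int (fst p)"
        using True p(2) by (intro mult_left_mono) auto
      then show ?thesis using 3 p(3) negW r(2)
        by (intro bexI[of _ "pt (- p)"]) (auto simp: inner_vec2)
    next
      case False
      have "u $ 1 * real_of_int (fst r) \<le> u $ 1 * real_of_int (fst p)"
        using False p(1) by (intro mult_left_mono_neg) auto
      then show ?thesis using 3 p(3) r(2)
        by (intro bexI[of _ "pt p"]) (auto simp: inner_vec2)
    qed
  qed
qed (use W in auto)

text \<open>The width is read off the two end points of the chain. In direction \<open>s = 0\<close>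
  a point of \<open>V\<close> attains the total rise, which is thus at most \<open>2 * b\<close>,
  while the net change is at least \<open>- 2 * b\<close>;
  \<open>\<bar>y\<bar> = 2 * max 0 y - y\<close> combines them to
  \<open>4 * b + 2 * b\<close>.\<close>

lemma upper_chain_sums:
  assumes V: "V \<subseteq> {- a..a} \<times> {- b..b}" and c: "upper_chain V p E"
  shows "(\<Sum>e\<in>E. fst e) \<le> 2 * a" "(\<Sum>e\<in>E. \<bar>snd e\<bar>) \<le> 6 * b"
proof -
  have pq: "p \<in> V" "p + \<Sum>E \<in> V" using c by (auto simp: upper_chain_def)
  have s: "fst (p + \<Sum>E) = fst p + (\<Sum>e\<in>E. fst e)" "snd (p + \<Sum>E) = snd p + (\<Sum>e\<in>E. snd e)"
    by (simp_all add: fst_sum snd_sum)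
  have fst_le: "- a \<le> fst r \<and> fst r \<le> a \<and> - b \<le> snd r \<and> snd r \<le> b" if "r \<in> V" for r
    using V that by (cases r) auto
  show "(\<Sum>e\<in>E. fst e) \<le> 2 * a"
    using fst_le[OF pq(1)] fst_le[OF pq(2)] s by linarith
  obtain r where "r \<in> V" "real_of_int (snd r) = real_of_int (snd p) + (\<Sum>e\<in>E. max 0 (real_of_int (snd e)))"
    using upper_chain_ht(2)[OF c, of 0] by auto
  moreover have "(\<Sum>e\<in>E. max 0 (real_of_int (snd e))) = real_of_int (\<Sum>e\<in>E. max 0 (snd e))"
    by (simp add: of_int_max)
  ultimately have "snd r = snd p + (\<Sum>e\<in>E. max 0 (snd e))" "r \<in> V" by linarith+
  then have "(\<Sum>e\<in>E. max 0 (snd e)) \<le> 2 * b"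
    using fst_le[of r] fst_le[OF pq(1)] by linarith
  moreover have "- 2 * b \<le> (\<Sum>e\<in>E. snd e)"
    using fst_le[OF pq(1)] fst_le[OF pq(2)] s by linarith
  moreover have "(\<Sum>e\<in>E. \<bar>snd e\<bar>) = (\<Sum>e\<in>E. 2 * max 0 (snd e) - snd e)"
    by (intro sum.cong) auto
  then have "(\<Sum>e\<in>E. \<bar>snd e\<bar>) = 2 * (\<Sum>e\<in>E. max 0 (snd e)) - (\<Sum>e\<in>E. snd e)"
    by (simp add: sum_subtractf sum_distrib_left)
  ultimately show "(\<Sum>e\<in>E. \<bar>snd e\<bar>) \<le> 6 * b" by linarith
qed

subsection \<open>Counting symmetric polygons in a box\<close>

text \<open>Rankin's trick: a counted \<open>F\<close> has weight
  \<open>exp M * (\<Prod>e\<in>F. exp (- c e)) \<ge> 1\<close>, the sum of the weights over all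
  subsets factors over \<open>G\<close>, and \<open>1 + t \<le> exp t\<close> bounds each
  factor.\<close>

lemma card_light_sets:
  fixes c :: "'a \<Rightarrow> real"
  assumes G: "finite G"
  shows "real (card {F. F \<subseteq> G \<and> (\<Sum>e\<in>F. c e) \<le> M}) \<le> exp (M + (\<Sum>e\<in>G. exp (- c e)))"
proof -
  let ?S = "{F. F \<subseteq> G \<and> (\<Sum>e\<in>F. c e) \<le> M}"
  have "real (card ?S) = (\<Sum>F\<in>?S. 1)" by simp
  also have "\<dots> \<le> (\<Sum>F\<in>?S. exp M * (\<Prod>e\<in>F. exp (- c e)))"
  proof (rule sum_mono)
    fix F assume F: "F \<in> ?S"
    then have "finite F" using G finite_subset by blast
    then have "exp M * (\<Prod>e\<in>F. exp (- c e)) = exp (M - (\<Sum>e\<in>F. c e))"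
      by (simp add: exp_sum[symmetric] exp_add[symmetric] sum_negf)
    then show "1 \<le> exp M * (\<Prod>e\<in>F. exp (- c e))" using F by simp
  qed
  also have "\<dots> \<le> (\<Sum>F\<in>Pow G. exp M * (\<Prod>e\<in>F. exp (- c e)))"
    using G by (intro sum_mono2) (auto intro!: prod_nonneg mult_nonneg_nonneg simp del: mult_le_cancel_left_pos zero_le_mult_iff)
  also have "\<dots> = exp M * (\<Prod>e\<in>G. exp (- c e) + 1)"
    by (simp add: prod_add[OF G] sum_distrib_left)
  also have "\<dots> \<le> exp M * (\<Prod>e\<in>G. exp (exp (- c e)))"
    by (intro mult_left_mono prod_mono) (auto simp: add.commute add_nonneg_nonneg)
  also have "\<dots> = exp (M + (\<Sum>e\<in>G. exp (- c e)))"
    using G by (simp add: exp_add exp_sum)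
  finally show ?thesis .
qed

text \<open>The induction runs on the sharper bound
  \<open>(1 - exp (- (\<alpha> * n))) / \<alpha>\<close>, the integral of
  \<open>exp (- \<alpha> x)\<close> from 0 to \<open>n\<close>; its step is
  \<open>1 + \<alpha> \<le> exp \<alpha>\<close>.\<close>

lemma sum_exp_neg_le:
  fixes \<alpha> :: real
  assumes "\<alpha> > 0"
  shows "(\<Sum>i\<in>{1..m::int}. exp (- (\<alpha> * i))) \<le> 1 / \<alpha>"
proof -
  have step: "(\<Sum>i\<in>{1..int n}. exp (- (\<alpha> * i))) \<le> (1 - exp (- (\<alpha> * n))) / \<alpha>" for n
  proof (induction n)
    case (Suc n)
    have "{1..int (Suc n)} = insert (int (Suc n)) {1..int n}" by auto
    then have "(\<Sum>i\<in>{1..int (Suc n)}. exp (- (\<alpha> * i)))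
      \<le> exp (- (\<alpha> * Suc n)) + (1 - exp (- (\<alpha> * n))) / \<alpha>"
      using Suc by simp
    moreover have "exp (- (\<alpha> * n)) = exp (- (\<alpha> * Suc n)) * exp \<alpha>"
      by (simp add: exp_add[symmetric] algebra_simps)
    moreover have "exp (- (\<alpha> * Suc n)) * (1 + \<alpha>) \<le> exp (- (\<alpha> * Suc n)) * exp \<alpha>"
      by (intro mult_left_mono) auto
    ultimately show ?case using assms by (simp add: field_simps)
  qed simp
  show ?thesis
  proof (cases "m \<ge> 0")
    case True
    have "(1 - exp (- (\<alpha> * nat m))) / \<alpha> \<le> 1 / \<alpha>" using assms by (simp add: field_simps)
    with step[of "nat m"] True show ?thesis by simp
  qed (use assms in simp)
qed

text \<open>The weights are \<open>\<alpha> x + \<beta> \<bar>y\<bar>\<close> with \<open>\<alpha> = T / a\<close>, \<open>\<beta> = T / b\<close> and \<open>T = (a b) powr (1/3)\<close>.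
  Horizontal vectors are left out: as \<open>\<beta>\<close> may be large, the row \<open>y = 0\<close> would spoil the
  bound \<open>2 / (\<alpha> \<beta>)\<close> on the sum over the grid.\<close>

lemma card_edge_sets:
  fixes a b :: int
  assumes ab: "a \<ge> 1" "b \<ge> 1"
  defines "G \<equiv> {1..2 * a} \<times> ({- 6 * b..6 * b} - {0})"
  shows "real (card {F. F \<subseteq> G \<and> (\<Sum>e\<in>F. fst e) \<le> 2 * a \<and> (\<Sum>e\<in>F. \<bar>snd e\<bar>) \<le> 6 * b})
    \<le> exp (10 * (a * b) powr (1/3))"
proof -
  define T where "T = real_of_int (a * b) powr (1/3)"
  define \<alpha> where "\<alpha> = T / a"
  define \<beta> where "\<beta> = T / b"
  have abpos: "real_of_int (a * b) > 0" using ab by (simp add: mult_pos_pos)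
  then have "T powr real 3 = real_of_int (a * b)"
    unfolding T_def powr_powr by simp
  moreover have "T > 0" unfolding T_def using ab by (simp del: of_int_mult)
  ultimately have T: "T > 0" "T ^ 3 = real_of_int (a * b)"
    using powr_realpow[of T 3] by simp_all
  have pos: "\<alpha> > 0" "\<beta> > 0" using T ab by (simp_all add: \<alpha>_def \<beta>_def)
  define c where "c e = \<alpha> * real_of_int (fst e) + \<beta> * real_of_int \<bar>snd e\<bar>" for e :: "int \<times> int"
  have "(\<Sum>y\<in>{- 6 * b..6 * b} - {0}. exp (- (\<beta> * \<bar>y\<bar>)))
    = (\<Sum>y\<in>{1..6 * b} \<union> uminus ` {1..6 * b}. exp (- (\<beta> * \<bar>y\<bar>)))"
  proof (rule sum.cong)
    show "{- 6 * b..6 * b} - {0} = {1..6 * b} \<union> uminus ` {1..6 * b}"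
    proof (intro equalityI subsetI)
      fix y assume y: "y \<in> {- 6 * b..6 * b} - {0}"
      show "y \<in> {1..6 * b} \<union> uminus ` {1..6 * b}"
      proof (cases "y > 0")
        case False
        then show ?thesis using y by (intro UnI2 image_eqI[of _ _ "- y"]) auto
      qed (use y in auto)
    qed auto
  qed auto
  also have "\<dots> = (\<Sum>y\<in>{1..6 * b}. exp (- (\<beta> * \<bar>y\<bar>))) + (\<Sum>y\<in>{1..6 * b}. exp (- (\<beta> * \<bar>y\<bar>)))"
  proof -
    have "(\<Sum>y\<in>uminus ` {1..6 * b}. exp (- (\<beta> * \<bar>y\<bar>))) = (\<Sum>y\<in>{1..6 * b}. exp (- (\<beta> * \<bar>y\<bar>)))"
      by (subst sum.reindex) (auto simp: inj_on_def)
    moreover have "{1..6 * b} \<inter> uminus ` {1..6 * b} = {}" by auto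
    ultimately show ?thesis by (metis sum.union_disjoint finite_atLeastAtMost_int finite_imageI)
  qed
  also have "\<dots> \<le> 1 / \<beta> + 1 / \<beta>"
    using sum_exp_neg_le[OF pos(2), of "6 * b"] by (intro add_mono) simp_all
  finally have y: "(\<Sum>y\<in>{- 6 * b..6 * b} - {0}. exp (- (\<beta> * \<bar>y\<bar>))) \<le> 2 / \<beta>" by simp
  have "(\<Sum>e\<in>G. exp (- c e)) =
     (\<Sum>x\<in>{1..2 * a}. exp (- (\<alpha> * x))) * (\<Sum>y\<in>{- 6 * b..6 * b} - {0}. exp (- (\<beta> * \<bar>y\<bar>)))"
    unfolding G_def c_def
    by (simp add: sum_product sum.cartesian_product exp_add[symmetric] case_prod_unfold)
  also have "\<dots> \<le> (1 / \<alpha>) * (2 / \<beta>)"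
    using sum_exp_neg_le[OF pos(1)] y pos by (intro mult_mono) (auto intro: sum_nonneg)
  \<comment> \<open>\<open>2 / (\<alpha> * \<beta>) = 2 a b / T\<^sup>2\<close>, and
    \<open>a b = T\<^sup>3\<close>.\<close>
  also have "\<dots> = 2 * T"
  proof -
    have "(1 / \<alpha>) * (2 / \<beta>) = 2 * real_of_int (a * b) / (T * T)"
      by (simp add: \<alpha>_def \<beta>_def)
    then show ?thesis using T by (simp add: T(2)[symmetric] power3_eq_cube del: of_int_mult)
  qed
  finally have grid: "(\<Sum>e\<in>G. exp (- c e)) \<le> 2 * T" .
  have finG: "finite G" by (simp add: G_def)
  have "{F. F \<subseteq> G \<and> (\<Sum>e\<in>F. fst e) \<le> 2 * a \<and> (\<Sum>e\<in>F. \<bar>snd e\<bar>) \<le> 6 * b}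
      \<subseteq> {F. F \<subseteq> G \<and> (\<Sum>e\<in>F. c e) \<le> 8 * T}"
  proof (intro Collect_mono impI conjI; elim conjE)
    fix F assume F: "(\<Sum>e\<in>F. fst e) \<le> 2 * a" "(\<Sum>e\<in>F. \<bar>snd e\<bar>) \<le> 6 * b"
    have "(\<Sum>e\<in>F. c e) = \<alpha> * real_of_int (\<Sum>e\<in>F. fst e) + \<beta> * real_of_int (\<Sum>e\<in>F. \<bar>snd e\<bar>)"
      by (simp add: c_def sum.distrib sum_distrib_left)
    also have "\<dots> \<le> \<alpha> * real_of_int (2 * a) + \<beta> * real_of_int (6 * b)"
      using F pos by (intro add_mono mult_left_mono) (simp_all add: less_imp_le del: of_int_sum of_int_mult)
    \<comment> \<open>The two terms are \<open>2 * T\<close> and \<open>6 * T\<close>; together with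
      the grid sum \<open>2 * T\<close> they yield the exponent \<open>10 * T\<close>.\<close>
    also have "\<dots> = 8 * T" using ab by (simp add: \<alpha>_def \<beta>_def)
    finally show "(\<Sum>e\<in>F. c e) \<le> 8 * T" .
  qed
  moreover have "finite {F. F \<subseteq> G \<and> (\<Sum>e\<in>F. c e) \<le> 8 * T}"
    using finG by simp
  ultimately have "card {F. F \<subseteq> G \<and> (\<Sum>e\<in>F. fst e) \<le> 2 * a \<and> (\<Sum>e\<in>F. \<bar>snd e\<bar>) \<le> 6 * b}
    \<le> card {F. F \<subseteq> G \<and> (\<Sum>e\<in>F. c e) \<le> 8 * T}"
    by (rule card_mono[rotated])
  then have "real (card {F. F \<subseteq> G \<and> (\<Sum>e\<in>F. fst e) \<le> 2 * a \<and> (\<Sum>e\<in>F. \<bar>snd e\<bar>) \<le> 6 * b})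
    \<le> real (card {F. F \<subseteq> G \<and> (\<Sum>e\<in>F. c e) \<le> 8 * T})" by simp
  also have "\<dots> \<le> exp (8 * T + (\<Sum>e\<in>G. exp (- c e)))"
    by (rule card_light_sets[OF finG])
  also have "\<dots> \<le> exp (10 * T)" using grid by simp
  finally show ?thesis unfolding T_def by simp
qed

text \<open>As the polygons are symmetric, the upper boundary alone determines them.\<close>

definition box_hulls :: "int \<Rightarrow> int \<Rightarrow> (real ^ 2) set set" where
  "box_hulls a b = {convex hull (pt ` V) | V.
     V \<noteq> {} \<and> uminus ` V = V \<and> V \<subseteq> {- a..a} \<times> {- b..b}}"

text \<open>\<open>P\<close> is encoded by the start of an upper chain, its horizontal edge if there
  is one, and its other edges. These have at most \<open>(2 a + 1) (2 b + 1)\<close>,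
  \<open>2 a + 1\<close> and, by \<open>card_edge_sets\<close>,
  \<open>exp (10 (a b) powr (1/3))\<close> values.\<close>

lemma card_box_hulls:
  fixes a b :: int
  assumes ab: "a \<ge> 1" "b \<ge> 1"
  shows "finite (box_hulls a b)"
    and "real (card (box_hulls a b))
      \<le> (2 * a + 1) ^ 2 * (2 * b + 1) * exp (10 * (a * b) powr (1/3))"
proof -
  define coded where "coded P c \<longleftrightarrow> (\<exists>V. P = convex hull (pt ` V) \<and> finite V \<and> uminus ` V = V \<and>
      V \<subseteq> {- a..a} \<times> {- b..b} \<and> upper_chain V (fst c) (snd c))" for P c
  have "\<forall>P\<in>box_hulls a b. \<exists>c. coded P c"
  proof
    fix P assume "P \<in> box_hulls a b"
    then obtain V where V: "P = convex hull (pt ` V)" "V \<noteq> {}" "uminus ` V = V"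
      "V \<subseteq> {- a..a} \<times> {- b..b}" unfolding box_hulls_def by blast
    moreover have "finite V" using V(4) by (rule finite_subset) simp
    moreover obtain p E where "upper_chain V p E"
      using upper_chain_exists[OF \<open>finite V\<close> V(2)] by blast
    ultimately have "coded P (p, E)" unfolding coded_def fst_conv snd_conv by blast
    then show "\<exists>c. coded P c" by blast
  qed
  then obtain code where code: "\<And>P. P \<in> box_hulls a b \<Longrightarrow> coded P (code P)"
    by (metis bchoice)
  have inj: "inj_on code (box_hulls a b)"
  proof (rule inj_onI)
    fix P Q assume PQ: "P \<in> box_hulls a b" "Q \<in> box_hulls a b" "code P = code Q"
    from code[OF PQ(1)] code[OF PQ(2)] PQ(3) show "P = Q"
      unfolding coded_def using upper_chain_hull_subset by (metis subset_antisym)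
  qed
  define G where "G = {1..2 * a} \<times> ({- 6 * b..6 * b} - {0})"
  define \<F> where "\<F> = {F. F \<subseteq> G \<and> (\<Sum>e\<in>F. fst e) \<le> 2 * a \<and> (\<Sum>e\<in>F. \<bar>snd e\<bar>) \<le> 6 * b}"
  define \<H> where "\<H> = insert {} ((\<lambda>x. {(x, 0::int)}) ` {1..2 * a})"
  define C where "C = ({- a..a} \<times> {- b..b}) \<times> (\<lambda>(A, B). A \<union> B) ` (\<H> \<times> \<F>)"
  have "finite G" by (simp add: G_def)
  then have fin: "finite \<F>" "finite \<H>" unfolding \<F>_def \<H>_def by simp_all
  then have finC: "finite C" unfolding C_def by simp
  have sub: "code ` box_hulls a b \<subseteq> C"
  proof (rule image_subsetI)
    fix P assume "P \<in> box_hulls a b"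
    obtain p E where pE: "code P = (p, E)" by (cases "code P")
    obtain V where V: "V \<subseteq> {- a..a} \<times> {- b..b}" "upper_chain V p E"
      using code[OF \<open>P \<in> box_hulls a b\<close>] unfolding coded_def pE by auto
    have E: "finite E" "\<And>e. e \<in> E \<Longrightarrow> fst e > 0" "p \<in> V"
      "\<And>e f. e \<in> E \<Longrightarrow> f \<in> E \<Longrightarrow> snd e = 0 \<Longrightarrow> snd f = 0 \<Longrightarrow> e = f"
      using V(2) unfolding upper_chain_def by blast+
    have le: "fst e \<le> 2 * a \<and> \<bar>snd e\<bar> \<le> 6 * b" if "e \<in> E" for e
    proof -
      have "fst e \<le> (\<Sum>e\<in>E. fst e)" "\<bar>snd e\<bar> \<le> (\<Sum>e\<in>E. \<bar>snd e\<bar>)"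
        using that E(1,2) by (auto intro!: member_le_sum simp: less_imp_le)
      then show ?thesis using upper_chain_sums[OF V] by linarith
    qed
    define A where "A = {e \<in> E. snd e = 0}"
    define B where "B = {e \<in> E. snd e \<noteq> 0}"
    have "A \<in> \<H>"
    proof (cases "A = {}")
      case False
      then obtain x where x: "(x, 0) \<in> A" unfolding A_def by force
      then have "A = {(x, 0)}" using E(4) unfolding A_def by force
      moreover have "x \<in> {1..2 * a}" using x le[of "(x, 0)"] E(2)[of "(x, 0)"] by (auto simp: A_def)
      ultimately show ?thesis unfolding \<H>_def by blast
    qed (simp add: \<H>_def)
    moreover have "B \<in> \<F>"
    proof -
      have "(\<Sum>e\<in>B. fst e) \<le> (\<Sum>e\<in>E. fst e)" "(\<Sum>e\<in>B. \<bar>snd e\<bar>) \<le> (\<Sum>e\<in>E. \<bar>snd e\<bar>)"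
        using E(1,2) unfolding B_def by (intro sum_mono2; auto simp: less_imp_le)+
      moreover have "B \<subseteq> G"
      proof
        fix e assume "e \<in> B"
        then have "e \<in> E" "snd e \<noteq> 0" by (auto simp: B_def)
        then show "e \<in> G" using le[of e] E(2)[of e] unfolding G_def by (cases e) auto
      qed
      ultimately show ?thesis using upper_chain_sums[OF V] unfolding \<F>_def by simp
    qed
    moreover have "E = A \<union> B" unfolding A_def B_def by blast
    ultimately have "E \<in> (\<lambda>(A, B). A \<union> B) ` (\<H> \<times> \<F>)" by auto
    moreover have "p \<in> {- a..a} \<times> {- b..b}" using E(3) V(1) by blast
    ultimately show "code P \<in> C" unfolding C_def pE by (simp only: mem_Times_iff fst_conv snd_conv)
  qed
  show "finite (box_hulls a b)"
    using inj sub finC by (meson finite_imageD finite_subset)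
  have "card (box_hulls a b) \<le> card C" using inj sub finC by (rule card_inj_on_le)
  also have "\<dots> \<le> nat (2 * a + 1) * nat (2 * b + 1) * (nat (2 * a + 1) * card \<F>)"
  proof -
    have "card \<H> \<le> Suc (card ((\<lambda>x. {(x, 0::int)}) ` {1..2 * a}))"
      unfolding \<H>_def by (rule card_insert_le_m1) simp_all
    also have "\<dots> \<le> Suc (card {1..2 * a})" by (simp add: card_image_le del: card_atLeastAtMost_int)
    also have "\<dots> = nat (2 * a + 1)" using ab by simp
    finally have "card (\<H> \<times> \<F>) \<le> nat (2 * a + 1) * card \<F>" by (simp add: card_cartesian_product)
    moreover have "card ((\<lambda>(A, B). A \<union> B) ` (\<H> \<times> \<F>)) \<le> card (\<H> \<times> \<F>)"
      using fin by (intro card_image_le) simp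
    ultimately have "card ((\<lambda>(A, B). A \<union> B) ` (\<H> \<times> \<F>)) \<le> nat (2 * a + 1) * card \<F>" by linarith
    then show ?thesis unfolding C_def by (simp add: card_cartesian_product algebra_simps)
  qed
  finally have "real (card (box_hulls a b))
    \<le> real (nat (2 * a + 1) * nat (2 * b + 1) * (nat (2 * a + 1) * card \<F>))"
    by (simp only: of_nat_le_iff)
  also have "\<dots> = (2 * a + 1) ^ 2 * (2 * b + 1) * real (card \<F>)"
    using ab by (simp add: power2_eq_square)
  also have "\<dots> \<le> (2 * a + 1) ^ 2 * (2 * b + 1) * exp (10 * (a * b) powr (1/3))"
    using card_edge_sets[OF ab] ab unfolding \<F>_def G_def
    by (intro mult_left_mono) (auto intro!: mult_nonneg_nonneg)
  finally show "real (card (box_hulls a b))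
      \<le> (2 * a + 1) ^ 2 * (2 * b + 1) * exp (10 * (a * b) powr (1/3))" .
qed

subsection \<open>Small boxes for symmetric polygons\<close>

text \<open>For symmetric convex \<open>P\<close> and \<open>k \<ge> 0\<close>, scaling down shows
  that no \<open>j\<close>-fold nonzero lattice vector with \<open>j > k\<close> lies in
  \<open>P\<close> either.\<close>

definition content_bound :: "(real ^ 2) set \<Rightarrow> int \<Rightarrow> bool" where
  "content_bound P k \<longleftrightarrow> (\<forall>v. v \<noteq> 0 \<longrightarrow> of_int (k + 1) *\<^sub>R pt v \<notin> P)"

lemma pt_scale: "pt (j * x, j * y) = of_int j *\<^sub>R pt (x, y)"
  by (simp add: vec2_eq_iff)

lemma symmetric_convex_scale:
  fixes P :: "'a::real_vector set"
  assumes "convex P" "\<And>x. x \<in> P \<Longrightarrow> - x \<in> P" "x \<in> P" "\<bar>t\<bar> \<le> 1"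
  shows "t *\<^sub>R x \<in> P"
proof -
  have "((1 + t) / 2) *\<^sub>R x + ((1 - t) / 2) *\<^sub>R (- x) \<in> P"
    using assms by (intro convexD) (auto simp: field_simps abs_le_iff)
  moreover have "((1 + t) / 2) *\<^sub>R x + ((1 - t) / 2) *\<^sub>R (- x) = ((1 + t) / 2 - (1 - t) / 2) *\<^sub>R x"
    by (simp add: scaleR_left_diff_distrib)
  moreover have "(1 + t) / 2 - (1 - t) / 2 = t" by (simp add: field_simps)
  ultimately show ?thesis by simp
qed

text \<open>Two points congruent modulo \<open>2 (k + 1)\<close> have half their difference, a \<open>(k + 1)\<close>-fold lattice
  vector, in \<open>P\<close>.\<close>

lemma card_lat_le_content:
  assumes P: "convex P" "\<And>x. x \<in> P \<Longrightarrow> - x \<in> P" and k: "content_bound P k" "k \<ge> 1"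
  shows "int (card (lat P)) \<le> 4 * (k + 1) ^ 2"
proof -
  define m where "m = 2 * (k + 1)"
  define f where "f z = (fst z mod m, snd z mod m)" for z :: "int \<times> int"
  have "inj_on f (lat P)"
  proof (rule inj_onI, rule ccontr)
    fix z z' assume z: "z \<in> lat P" "z' \<in> lat P" "f z = f z'" "z \<noteq> z'"
    then have "m dvd fst z - fst z'" "m dvd snd z - snd z'"
      by (auto simp: f_def mod_eq_dvd_iff)
    then obtain x y where xy: "fst z - fst z' = m * x" "snd z - snd z' = m * y"
      by (auto elim!: dvdE)
    then have "(x, y) \<noteq> 0" using z(4) by (auto simp: prod_eq_iff)
    moreover have "(1 / 2) *\<^sub>R pt z + (1 / 2) *\<^sub>R (- pt z') \<in> P"
      using P z by (intro convexD) (auto simp: lat_def)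
    moreover have "(1 / 2) *\<^sub>R pt z + (1 / 2) *\<^sub>R (- pt z') = of_int (k + 1) *\<^sub>R pt (x, y)"
    proof -
      have "real_of_int (fst z) - real_of_int (fst z') = real_of_int (m * x)"
        "real_of_int (snd z) - real_of_int (snd z') = real_of_int (m * y)"
        by (simp_all only: xy[symmetric] of_int_diff)
      then show ?thesis by (simp add: vec2_eq_iff m_def algebra_simps)
    qed
    ultimately show False using k(1) unfolding content_bound_def by metis
  qed
  moreover have "f ` lat P \<subseteq> {0..<m} \<times> {0..<m}"
    using k(2) by (auto simp: f_def m_def)
  ultimately have "card (lat P) \<le> card ({0..<m} \<times> {0..<m})"
    by (rule card_inj_on_le) simp
  also have "\<dots> = nat m * nat m" by (simp add: card_cartesian_product)
  finally have "int (card (lat P)) \<le> int (nat m * nat m)" by (simp only: of_nat_le_iff)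
  also have "\<dots> = 4 * (k + 1) ^ 2" using k(2) by (simp add: m_def power2_eq_square algebra_simps)
  finally show ?thesis .
qed

text \<open>In the triangle spanned by \<open>(\<plusminus>k, 0)\<close> and \<open>(x0, b)\<close>, every row up to height \<open>b / 2\<close> has
  length at least \<open>k\<close>.\<close>

lemma base_times_height_le:
  assumes P: "convex P" "\<And>x. x \<in> P \<Longrightarrow> - x \<in> P" "finite (lat P)"
    and kb: "pt (k, 0) \<in> P" "k \<ge> 1" "pt (x0, b) \<in> P" "b \<ge> 1"
  shows "k * b \<le> 2 * int (card (lat P))"
proof -
  \<comment> \<open>\<open>c j\<close> is the abscissa at height \<open>j\<close> on the side from
    \<open>(- k, 0)\<close> to \<open>(x0, b)\<close>. For \<open>2 j \<le> b\<close> the row there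
    has length \<open>2 k (1 - j / b) \<ge> k\<close>, so it holds the \<open>k\<close> integers
    starting from \<open>\<lceil>c j\<rceil>\<close>.\<close>
  define c where "c j = - real_of_int k * (1 - of_int j / of_int b) + of_int x0 * (of_int j / of_int b)" for j :: int
  define f where "f u = (\<lceil>c (fst u)\<rceil> + snd u, fst u)" for u :: "int \<times> int"
  have "f ` ({0..b div 2} \<times> {0..<k}) \<subseteq> lat P"
  proof (rule image_subsetI)
    fix u assume u: "u \<in> {0..b div 2} \<times> {0..<k}"
    obtain j i where ji: "u = (j, i)" "0 \<le> j" "2 * j \<le> b" "0 \<le> i" "i \<le> k - 1"
      using u by (cases u) auto
    define l where "l = real_of_int j / of_int b"
    have "2 * real_of_int j \<le> of_int b" using ji(3) by linarith
    then have l: "0 \<le> l" "l \<le> 1 / 2" "l * of_int b = of_int j"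
      using ji kb(4) by (simp_all add: l_def field_simps)
    define x where "x = \<lceil>c j\<rceil> + i"
    \<comment> \<open>The line from \<open>(x0, b)\<close> through \<open>(x, j)\<close> meets the
      base in \<open>(t, 0)\<close>.\<close>
    define t where "t = (real_of_int x - of_int x0 * l) / (1 - l)"
    have c: "c j = - real_of_int k * (1 - l) + of_int x0 * l" by (simp add: c_def l_def)
    have "real_of_int i \<le> of_int k - 1" using ji(5) by linarith
    then have "c j \<le> real_of_int x" "real_of_int x \<le> c j + of_int k"
      unfolding x_def using ceiling_correct[of "c j"] ji(4) by (simp_all, linarith+)
    moreover have "real_of_int k * l \<le> real_of_int k * (1 - l)"
      using l kb(2) by (intro mult_left_mono) auto
    ultimately have "- real_of_int k * (1 - l) \<le> real_of_int x - of_int x0 * l"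
      "real_of_int x - of_int x0 * l \<le> real_of_int k * (1 - l)"
      unfolding c by (simp_all add: algebra_simps)
    then have t: "- real_of_int k \<le> t" "t \<le> real_of_int k"
      using l unfolding t_def by (simp_all add: pos_le_divide_eq pos_divide_le_eq)
    have "(t / real_of_int k) *\<^sub>R pt (k, 0) \<in> P"
      using t kb(2) by (intro symmetric_convex_scale[OF P(1,2) kb(1)]) (auto simp: field_simps abs_le_iff)
    then have "l *\<^sub>R pt (x0, b) + (1 - l) *\<^sub>R ((t / real_of_int k) *\<^sub>R pt (k, 0)) \<in> P"
      using P(1) kb(3) l by (intro convexD) auto
    also have "l *\<^sub>R pt (x0, b) + (1 - l) *\<^sub>R ((t / real_of_int k) *\<^sub>R pt (k, 0)) = pt (x, j)"
      using l kb(2) by (simp add: vec2_eq_iff t_def field_simps)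
    finally show "f u \<in> lat P" by (simp add: f_def ji(1) x_def lat_def)
  qed
  moreover have "inj_on f ({0..b div 2} \<times> {0..<k})"
    by (auto simp: inj_on_def f_def)
  ultimately have "card ({0..b div 2} \<times> {0..<k}) \<le> card (lat P)"
    using P(3) by (intro card_inj_on_le)
  then have "int (nat (b div 2 + 1) * nat k) \<le> int (card (lat P))"
    by (simp add: card_cartesian_product del: of_nat_mult)
  then have "(b div 2 + 1) * k \<le> int (card (lat P))"
    using kb by simp
  \<comment> \<open>There are \<open>b div 2 + 1\<close> rows, which is more than half of
    \<open>b\<close> also for odd \<open>b\<close>.\<close>
  moreover have "b * k \<le> (2 * (b div 2 + 1)) * k"
    using kb(2) by (intro mult_right_mono) auto
  ultimately show ?thesis by (simp add: algebra_simps)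
qed

text \<open>The midpoint of \<open>z\<close> and the multiple of \<open>- (x0, b)\<close> at height \<open>- snd z\<close> lies on the axis, where
  the content bounds it.\<close>

lemma abs_fst_le:
  assumes P: "convex P" "\<And>x. x \<in> P \<Longrightarrow> - x \<in> P"
    and k: "content_bound P k" "k \<ge> 1" and x0: "pt (x0, b) \<in> P" "0 \<le> x0"
    and b: "b \<ge> 1" "\<And>z. pt z \<in> P \<Longrightarrow> snd z \<le> b" and z: "pt z \<in> P"
  shows "\<bar>fst z\<bar> \<le> 2 * (k + 1) + x0"
proof -
  have main: "\<bar>fst z\<bar> \<le> 2 * (k + 1) + x0" if z: "pt z \<in> P" "snd z \<ge> 0" for z
  proof (rule ccontr)
    assume big: "\<not> \<bar>fst z\<bar> \<le> 2 * (k + 1) + x0"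
    define l where "l = real_of_int (snd z) / of_int b"
    have l: "0 \<le> l" "l \<le> 1" "l * of_int b = snd z"
      using b z by (simp_all add: l_def)
    define s where "s = (real_of_int (fst z) - l * of_int x0) / 2"
    have "(1 / 2) *\<^sub>R pt z + (1 / 2) *\<^sub>R ((- l) *\<^sub>R pt (x0, b)) \<in> P"
      using P z x0 l by (intro convexD symmetric_convex_scale) auto
    also have "(1 / 2) *\<^sub>R pt z + (1 / 2) *\<^sub>R ((- l) *\<^sub>R pt (x0, b)) = s *\<^sub>R pt (1, 0)"
      using l(3) by (simp add: vec2_eq_iff s_def field_simps)
    finally have s: "s *\<^sub>R pt (1, 0) \<in> P" .
    define y where "y = l * real_of_int x0"
    have "y \<le> of_int x0" "0 \<le> y"
      using l x0(2) by (simp_all add: y_def mult_left_le_one_le)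
    moreover have "fst z > 2 * (k + 1) + x0 \<or> fst z < - (2 * (k + 1) + x0)"
      using big by linarith
    then have "real_of_int (fst z) > of_int (2 * (k + 1) + x0) \<or>
        real_of_int (fst z) < of_int (- (2 * (k + 1) + x0))"
      by (simp only: of_int_less_iff)
    then have "real_of_int (fst z) > 2 * of_int k + 2 + of_int x0 \<or>
        real_of_int (fst z) < - (2 * of_int k + 2 + of_int x0)"
      by simp
    moreover have "real_of_int k \<ge> 1" using k(2) by simp
    moreover have "2 * s = real_of_int (fst z) - y" by (simp add: s_def y_def)
    \<comment> \<open>Subtracting \<open>y\<close>, which lies between 0 and \<open>x0\<close>,
      leaves more than \<open>2 * (k + 1)\<close> in absolute value. Half of it gives a multiple of
      \<open>(1, 0)\<close> in \<open>P\<close> that can be scaled down to the excluded factor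
      \<open>k + 1\<close>.\<close>
    ultimately have "\<bar>s\<bar> \<ge> real_of_int k + 1" by (elim disjE) linarith+
    then have s_ge: "\<bar>s\<bar> \<ge> real_of_int (k + 1)" by simp
    then have "(real_of_int (k + 1) / s) *\<^sub>R (s *\<^sub>R pt (1, 0)) \<in> P"
      using k(2) by (intro symmetric_convex_scale[OF P s]) (auto simp: field_simps abs_real_def split: if_splits)
    moreover have "s \<noteq> 0" using s_ge k(2) by auto
    ultimately have "real_of_int (k + 1) *\<^sub>R pt (1, 0) \<in> P" by simp
    moreover have "(1, 0) \<noteq> (0 :: int \<times> int)" by (simp add: prod_eq_iff)
    ultimately show False using k(1) unfolding content_bound_def by blast
  qed
  show ?thesis
  proof (cases "snd z \<ge> 0")
    case True
    then show ?thesis using main z by blast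
  next
    case False
    have "pt (- z) \<in> P" using P(2)[OF z] by (simp add: pt_minus)
    then show ?thesis using main[of "- z"] False by simp
  qed
qed

section \<open>Unimodular normal form\<close>

definition centred :: "(real ^ 2) set \<Rightarrow> nat \<Rightarrow> int \<Rightarrow> bool" where
  "centred P w k \<longleftrightarrow> convex P \<and> (\<forall>x\<in>P. - x \<in> P) \<and> finite (lat P) \<and> card (lat P) = w \<and>
     interior P \<noteq> {} \<and> P = convex hull (pt ` lat P) \<and> content_bound P k"

text \<open>The adjugate matrix is an integral inverse (\<open>\<nu>\<close> inverts
  \<open>\<mu>\<close>), so the linear map permutes the lattice and every clause of
  \<open>centred\<close> carries over, including the content bound.\<close>

lemma centred_unimodular:
  fixes a b c d :: int
  assumes P: "centred P w k" and det: "a * d - b * c = 1"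
  shows "\<exists>Q. centred Q w k \<and> lattice_equivalent P Q \<and>
    lat Q = (\<lambda>z. (a * fst z + b * snd z, c * fst z + d * snd z)) ` lat P"
proof -
  define \<mu> where "\<mu> z = (a * fst z + b * snd z, c * fst z + d * snd z)" for z :: "int \<times> int"
  define \<nu> where "\<nu> z = (d * fst z - b * snd z, - c * fst z + a * snd z)" for z :: "int \<times> int"
  have "\<mu> (\<nu> z) = ((a * d - b * c) * fst z, (a * d - b * c) * snd z)"
    "\<nu> (\<mu> z) = ((a * d - b * c) * fst z, (a * d - b * c) * snd z)" for z
    by (simp_all add: \<mu>_def \<nu>_def algebra_simps)
  then have \<mu>\<nu>: "\<mu> (\<nu> z) = z" "\<nu> (\<mu> z) = z" for z
    by (simp_all add: det)
  define A :: "real ^ 2 ^ 2" where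
    "A = vector [vector [of_int a, of_int b], vector [of_int c, of_int d]]"
  have A_nth: "(A *v x) $ 1 = of_int a * x $ 1 + of_int b * x $ 2"
    "(A *v x) $ 2 = of_int c * x $ 1 + of_int d * x $ 2" for x
    by (simp_all add: A_def matrix_vector_mult_def sum_2)
  have A_pt: "A *v pt z = pt (\<mu> z)" for z
    by (simp add: vec2_eq_iff A_nth \<mu>_def)
  have "det A = of_int (a * d - b * c)"
    by (simp add: det_2 A_def)
  then have inv: "invertible A" by (simp add: invertible_det_nz det)
  then have injA: "inj ((*v) A)" by (simp add: inj_matrix_vector_mult)
  define Q where "Q = (*v) A ` P"
  have mem: "A *v x \<in> Q \<longleftrightarrow> x \<in> P" for x
    unfolding Q_def using injA by (simp add: inj_image_mem_iff)
  have latQ: "lat Q = \<mu> ` lat P"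
  proof (intro equalityI subsetI)
    fix z assume "z \<in> lat Q"
    then have "\<nu> z \<in> lat P" using A_pt[of "\<nu> z"] mem[of "pt (\<nu> z)"] by (simp add: lat_def \<mu>\<nu>)
    then show "z \<in> \<mu> ` lat P" using \<mu>\<nu> by (metis imageI)
  next
    fix z assume "z \<in> \<mu> ` lat P"
    then obtain y where "y \<in> lat P" "z = \<mu> y" by blast
    then show "z \<in> lat Q" using A_pt[of y] mem[of "pt y"] by (simp add: lat_def)
  qed
  have inj\<mu>: "inj_on \<mu> S" for S using \<mu>\<nu>(2) by (metis inj_onI)
  have pt\<mu>: "pt ` \<mu> ` S = (*v) A ` pt ` S" for S by (simp add: image_image A_pt)
  have "centred Q w k"
    unfolding centred_def
  proof (intro conjI)
    show "convex Q" unfolding Q_def using P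
      by (intro convex_linear_image) (auto simp: centred_def)
    show "\<forall>x\<in>Q. - x \<in> Q"
    proof
      fix x assume "x \<in> Q"
      then obtain y where y: "y \<in> P" "x = A *v y" unfolding Q_def by blast
      have "- x = A *v (- y)" unfolding y(2) by (rule linear_neg[OF matrix_vector_mul_linear, symmetric])
      moreover have "- y \<in> P" using P y(1) by (simp add: centred_def)
      ultimately show "- x \<in> Q" using mem by metis
    qed
    show "finite (lat Q)" "card (lat Q) = w"
      using P by (auto simp: latQ centred_def card_image inj\<mu>)
    show "interior Q \<noteq> {}"
      using P injA unfolding Q_def by (simp add: interior_injective_linear_image centred_def)
    show "Q = convex hull (pt ` lat Q)"
    proof -
      have "P = convex hull (pt ` lat P)" using P unfolding centred_def by (elim conjE)
      from arg_cong[OF this, of "image ((*v) A)"]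
      show ?thesis unfolding latQ pt\<mu>
        by (simp only: Q_def convex_hull_linear_image[OF matrix_vector_mul_linear])
    qed
    show "content_bound Q k"
      unfolding content_bound_def
    proof (intro allI impI notI)
      fix v assume v: "v \<noteq> 0" "of_int (k + 1) *\<^sub>R pt v \<in> Q"
      have "of_int (k + 1) *\<^sub>R pt v = A *v (of_int (k + 1) *\<^sub>R pt (\<nu> v))"
        by (simp add: matrix_vector_mult_scaleR A_pt \<mu>\<nu>)
      then have "of_int (k + 1) *\<^sub>R pt (\<nu> v) \<in> P" using v(2) mem by metis
      moreover have "\<nu> v \<noteq> 0" using \<mu>\<nu>(1)[of v] v(1) by (auto simp: \<mu>_def prod_eq_iff)
      ultimately show False using P unfolding centred_def content_bound_def by blast
    qed
  qed
  moreover have "lattice_equivalent P Q"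
    unfolding lattice_equivalent_def affine_transformation_def
  proof (intro exI conjI)
    show "invertible A" by (rule inv)
    show "(*v) A = (\<lambda>x. A *v x + 0)" by simp
    have "\<mu> ` UNIV = UNIV" using \<mu>\<nu>(1) by (metis surjI)
    then show "(*v) A ` int_lattice = int_lattice"
      unfolding range_pt[symmetric] pt\<mu>[symmetric] by simp
    show "(*v) A ` P = Q" by (simp add: Q_def)
  qed
  ultimately show ?thesis using latQ unfolding \<mu>_def by blast
qed

text \<open>Otherwise symmetry puts all lattice points on the horizontal axis, and their hull has
  empty interior.\<close>

lemma centred_positive_height:
  assumes "centred P w k"
  shows "\<exists>z\<in>lat P. snd z > 0"
proof (rule ccontr)
  assume no: "\<not> ?thesis"
  have "snd z = 0" if "z \<in> lat P" for z
  proof -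
    have "- z \<in> lat P" using assms that by (simp add: centred_def lat_def pt_minus)
    then have "\<not> snd z > 0" "\<not> snd (- z) > 0" using no that by blast+
    then show ?thesis by simp
  qed
  then have "pt ` lat P \<subseteq> {x. axis 2 1 \<bullet> x = (0::real)}"
    by (auto simp: inner_vec2 axis_def)
  then have "convex hull (pt ` lat P) \<subseteq> {x. axis 2 1 \<bullet> x = (0::real)}"
    by (intro hull_minimal) (auto simp: convex_hyperplane)
  then have "interior P \<subseteq> interior {x. axis 2 1 \<bullet> x = (0::real)}"
    using assms by (intro interior_mono) (simp add: centred_def)
  also have "\<dots> = {}" by (rule interior_hyperplane) (simp add: axis_eq_0_iff)
  finally show False using assms by (simp add: centred_def)
qed

text \<open>The largest multiple \<open>k v\<close> is moved to \<open>(k, 0)\<close>, then a shear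
  brings a highest lattice point to \<open>(x0, b)\<close> with \<open>0 \<le> x0 < b\<close>. The
  height is controlled by \<open>base_times_height_le\<close>, the width by
  \<open>abs_fst_le\<close>.\<close>

lemma centred_normal_form:
  assumes P: "convex P" "\<And>x. x \<in> P \<Longrightarrow> - x \<in> P" "finite (lat P)" "card (lat P) = w"
     "interior P \<noteq> {}" "P = convex hull (pt ` lat P)"
  shows "\<exists>k b Q. 1 \<le> k \<and> k \<le> int w \<and> 1 \<le> b \<and> k * b \<le> 2 * int w \<and>
     lattice_equivalent P Q \<and> Q \<in> box_hulls (36 * k) b"
proof -
  define K where "K = {j. 1 \<le> j \<and> (\<exists>v. v \<noteq> 0 \<and> of_int j *\<^sub>R pt v \<in> P)}"
  have K_le: "j \<le> int w" if j: "j \<in> K" for j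
  proof -
    obtain v where v: "v \<noteq> 0" "of_int j *\<^sub>R pt v \<in> P" "1 \<le> j"
      using j unfolding K_def by blast
    define f where "f i = (i * fst v, i * snd v)" for i :: int
    have "f ` {1..j} \<subseteq> lat P"
    proof (rule image_subsetI)
      fix i assume i: "i \<in> {1..j}"
      then have "(real_of_int i / of_int j) *\<^sub>R (of_int j *\<^sub>R pt v) \<in> P"
        by (intro symmetric_convex_scale[OF P(1,2) v(2)]) auto
      then show "f i \<in> lat P" using v(3) by (simp add: f_def lat_def pt_scale)
    qed
    moreover have "inj_on f {1..j}" using v(1) by (auto simp: inj_on_def f_def prod_eq_iff)
    ultimately have "card {1..j} \<le> card (lat P)" using P(3) by (intro card_inj_on_le)
    then show ?thesis using v(3) P(4) by simp
  qed
  have "\<exists>z\<in>lat P. z \<noteq> 0"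
  proof (rule ccontr)
    assume "\<not> ?thesis"
    then have "pt ` lat P \<subseteq> {0}" by auto
    then have "convex hull (pt ` lat P) \<subseteq> {0}" by (intro hull_minimal) auto
    then have "P \<subseteq> {0}" using P(6) by simp
    then have "interior P \<subseteq> interior {0}" by (rule interior_mono)
    then show False using P(5) by simp
  qed
  then have "1 \<in> K" by (auto simp: K_def lat_def)
  moreover have finK: "finite K"
  proof (rule finite_subset)
    show "K \<subseteq> {1..int w}"
    proof
      fix j assume "j \<in> K"
      then show "j \<in> {1..int w}" using K_le[of j] by (simp add: K_def)
    qed
  qed simp
  ultimately have "Max K \<in> K" by (intro Max_in) auto
  define k where "k = Max K"
  have "k \<in> K" using \<open>Max K \<in> K\<close> by (simp add: k_def)
  then have k: "1 \<le> k" "k \<le> int w" using K_le[of k] by (simp_all add: K_def)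
  obtain v where v: "v \<noteq> 0" "of_int k *\<^sub>R pt v \<in> P"
    using \<open>k \<in> K\<close> unfolding K_def by blast
  have K_max: "j \<le> k" if "j \<in> K" for j using finK that by (simp add: k_def)
  have "content_bound P k"
    unfolding content_bound_def
  proof (intro allI impI notI)
    fix u assume "u \<noteq> 0" "of_int (k + 1) *\<^sub>R pt u \<in> P"
    then have "k + 1 \<in> K" unfolding K_def using k by (intro CollectI conjI exI[of _ u]) auto
    then show False using K_max by fastforce
  qed
  then have cP: "centred P w k" using P by (auto simp: centred_def)
  define g where "g = gcd (fst v) (snd v)"
  have g: "g \<ge> 1" using v(1) unfolding g_def by (auto simp: prod_eq_iff intro: Suc_leI int_one_le_iff_zero_less[THEN iffD2])
  obtain v1 v2 where v12: "fst v = g * v1" "snd v = g * v2"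
    unfolding g_def by (metis dvdE gcd_dvd1 gcd_dvd2)
  \<comment> \<open>The \<open>k * g\<close>-fold multiple of \<open>v / g\<close> lies in
    \<open>P\<close>, so maximality of \<open>k\<close> makes \<open>v\<close> primitive.\<close>
  have "k * g \<in> K"
  proof -
    have "v = (g * v1, g * v2)" using v12 by (simp add: prod_eq_iff)
    then have "of_int (k * g) *\<^sub>R pt (v1, v2) \<in> P" using v(2) by (simp add: pt_scale)
    moreover have "(v1, v2) \<noteq> 0" using v(1) v12 by (auto simp: prod_eq_iff)
    moreover have "1 \<le> k * g" using mult_mono[of 1 k 1 g] k g by simp
    ultimately show ?thesis unfolding K_def by blast
  qed
  then have "k * g \<le> k * 1" using K_max by simp
  then have "g = 1" using k g by (simp add: mult_le_cancel_left)
  \<comment> \<open>By Bezout the rows \<open>(u1, u2)\<close> and \<open>(- snd v, fst v)\<close>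
    form a matrix of determinant 1 that sends \<open>v\<close> to \<open>(1, 0)\<close>.\<close>
  obtain u1 u2 where u: "u1 * fst v + u2 * snd v = 1"
    using bezout_int[of "fst v" "snd v"] \<open>g = 1\<close> unfolding g_def by auto
  then have "u1 * fst v - u2 * (- snd v) = 1" by simp
  from centred_unimodular[OF cP this] obtain Q where Q: "centred Q w k" "lattice_equivalent P Q"
    "lat Q = (\<lambda>z. (u1 * fst z + u2 * snd z, - snd v * fst z + fst v * snd z)) ` lat P" by auto
  have "(k * fst v, k * snd v) \<in> lat P" using v(2) by (simp add: lat_def pt_scale)
  moreover have "u1 * (k * fst v) + u2 * (k * snd v) = k"
    using arg_cong[OF u, of "\<lambda>t. k * t"] by (simp add: algebra_simps)
  ultimately have kQ: "(k, 0) \<in> lat Q"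
    unfolding Q(3) by (intro image_eqI) (auto simp: algebra_simps)
  define b where "b = Max (snd ` lat Q)"
  have finQ: "finite (lat Q)" using Q(1) by (simp add: centred_def)
  obtain z where "z \<in> lat Q" "snd z > 0" using centred_positive_height[OF Q(1)] by blast
  then have "snd z \<le> b" "0 < snd z" using finQ by (simp_all add: b_def)
  then have "1 \<le> b" by simp
  have "b \<in> snd ` lat Q" unfolding b_def using finQ kQ by (intro Max_in) auto
  then obtain x where x: "(x, b) \<in> lat Q" by auto
  have snd_le: "snd z \<le> b" if "z \<in> lat Q" for z
    using that finQ by (simp add: b_def)
  \<comment> \<open>A shear fixing the horizontal axis reduces the abscissa of the highest point
    modulo \<open>b\<close>.\<close>
  have "1 * 1 - (- (x div b)) * 0 = (1::int)" by simp
  from centred_unimodular[OF Q(1) this] obtain R where R: "centred R w k" "lattice_equivalent Q R"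
    "lat R = (\<lambda>z. (fst z - (x div b) * snd z, snd z)) ` lat Q" by auto
  define x0 where "x0 = x mod b"
  have x0: "0 \<le> x0" "x0 < b" using \<open>1 \<le> b\<close> by (simp_all add: x0_def)
  have "(x0, b) \<in> lat R"
    unfolding R(3) x0_def by (rule image_eqI[OF _ x]) (simp add: minus_div_mult_eq_mod)
  moreover have "(k, 0) \<in> lat R"
    unfolding R(3) by (rule image_eqI[OF _ kQ]) simp
  ultimately have pts: "pt (x0, b) \<in> R" "pt (k, 0) \<in> R" by (simp_all add: lat_def)
  have snd_leR: "snd z \<le> b" if "pt z \<in> R" for z
  proof -
    have "z \<in> lat R" using that by (simp add: lat_def)
    then show ?thesis unfolding R(3) using snd_le by auto
  qed
  have cR: "convex R" "\<And>x. x \<in> R \<Longrightarrow> - x \<in> R" "finite (lat R)" "card (lat R) = w"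
     "R = convex hull (pt ` lat R)" "content_bound R k"
    using R(1) by (auto simp: centred_def)
  have kb: "k * b \<le> 2 * int w"
    using base_times_height_le[OF cR(1-3) pts(2) k(1) pts(1) \<open>1 \<le> b\<close>] cR(4) by simp
  \<comment> \<open>\<open>k b \<le> 2 w\<close> and \<open>w \<le> 16 k\<^sup>2\<close> give
    \<open>b \<le> 32 k\<close>; then \<open>2 (k + 1) + x0 \<le> 4 k + 32 k\<close>, hence the
    factor 36.\<close>
  have "int w \<le> 4 * (k + 1) ^ 2"
    using card_lat_le_content[OF cR(1,2,6) k(1)] cR(4) by simp
  also have "\<dots> \<le> 4 * (2 * k) ^ 2" using k(1) by (intro mult_left_mono power_mono) auto
  finally have "k * b \<le> k * (32 * k)" using kb by (simp add: power2_eq_square)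
  then have b32: "b \<le> 32 * k" using k(1) by simp
  have negR: "- z \<in> lat R" if "z \<in> lat R" for z
    using that cR(2)[of "pt z"] by (simp add: lat_def pt_minus)
  have "lat R \<subseteq> {- (36 * k)..36 * k} \<times> {- b..b}"
  proof
    fix z assume z: "z \<in> lat R"
    have "\<bar>fst z\<bar> \<le> 2 * (k + 1) + x0"
      using z by (intro abs_fst_le[OF cR(1,2,6) k(1) pts(1) x0(1) \<open>1 \<le> b\<close> snd_leR]) (auto simp: lat_def)
    moreover have "2 * (k + 1) + x0 \<le> 36 * k" using x0 b32 k(1) by simp
    ultimately have "\<bar>fst z\<bar> \<le> 36 * k" by (rule order_trans)
    moreover have "snd z \<le> b" "snd (- z) \<le> b"
      using z negR[OF z] snd_leR unfolding lat_def by blast+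
    ultimately show "z \<in> {- (36 * k)..36 * k} \<times> {- b..b}" by (cases z) auto
  qed
  moreover have "uminus ` lat R = lat R"
    using negR by (auto intro: image_eqI[of _ uminus "- z" for z])
  moreover have "lat R \<noteq> {}" using pts(1) by (auto simp: lat_def)
  ultimately have "R \<in> box_hulls (36 * k) b"
    unfolding box_hulls_def using cR(5) by blast
  moreover have "lattice_equivalent P R" using Q(2) R(2) by (rule lattice_equivalent_trans)
  ultimately show ?thesis using k kb \<open>1 \<le> b\<close> by blast
qed

text \<open>The centre is a lattice point, so moving it to the origin is a lattice equivalence, and
  the normal form applies to the translate.\<close>

lemma equivalent_to_box_hull:
  assumes "P \<in> symmetric_polytopes w"
  shows "\<exists>k b Q. 1 \<le> k \<and> k \<le> int w \<and> 1 \<le> b \<and> k * b \<le> 2 * int w \<and>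
     lattice_equivalent P Q \<and> Q \<in> box_hulls (36 * k) b"
proof -
  have P: "lattice_polytope P" "interior P \<noteq> {}" "centrally_symmetric P" "card (lat P) = w"
    using assms by (auto simp: symmetric_polytopes_def lattice_point_count_lat)
  obtain c where c: "c \<in> int_lattice" "(\<lambda>x. 2 *\<^sub>R c - x) ` P = P"
    using P(3) by (auto simp: centrally_symmetric_def)
  obtain z where z: "c = pt z" using c(1) range_pt by blast
  define Q where "Q = (\<lambda>x. - c + x) ` P"
  have mem: "x \<in> Q \<longleftrightarrow> c + x \<in> P" for x
    unfolding Q_def by (auto intro!: image_eqI[of _ _ "c + x"])
  have latP: "lat P = (\<lambda>y. z + y) ` lat Q"
  proof (intro equalityI subsetI)
    fix y assume "y \<in> lat P"
    then have "y - z \<in> lat Q" by (simp add: lat_def mem z pt_diff)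
    then show "y \<in> (\<lambda>y. z + y) ` lat Q" by (intro image_eqI[of _ _ "y - z"]) simp_all
  qed (auto simp: lat_def mem z pt_add)
  have hull: "P = convex hull (pt ` lat P)" by (rule lattice_polytope_eq_hull[OF P(1)])
  have 1: "convex Q" unfolding Q_def
    by (subst hull) (rule convex_translation[OF convex_convex_hull])
  have 2: "- x \<in> Q" if "x \<in> Q" for x
  proof -
    have "2 *\<^sub>R c - (c + x) \<in> P" using c(2) that mem by blast
    moreover have "2 *\<^sub>R c - (c + x) = c + - x" by (simp add: scaleR_2)
    ultimately show ?thesis unfolding mem by simp
  qed
  have 3: "finite (lat Q)" unfolding Q_def
    using bounded_lattice_polytope[OF P(1)] by (intro finite_lat bounded_translation)
  have 4: "card (lat Q) = w"
    using P(4) unfolding latP by (simp add: card_image)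
  have 5: "interior Q \<noteq> {}"
    using P(2) unfolding Q_def interior_translation by simp
  have 6: "Q = convex hull (pt ` lat Q)"
  proof -
    have "pt ` lat P = (\<lambda>x. c + x) ` pt ` lat Q"
      unfolding latP by (simp add: image_image pt_add z)
    then have "P = (\<lambda>x. c + x) ` (convex hull (pt ` lat Q))"
      using hull by (simp add: convex_hull_translation)
    from arg_cong[OF this, of "image (\<lambda>x. - c + x)"] show ?thesis
      unfolding Q_def[symmetric] image_image by simp
  qed
  have "lattice_equivalent P Q"
    unfolding lattice_equivalent_def affine_transformation_def
  proof (intro exI conjI)
    show "invertible (mat 1 :: real ^ 2 ^ 2)" unfolding invertible_def by (rule exI[of _ "mat 1"]) simp
    show "(\<lambda>x. - c + x) = (\<lambda>x. (mat 1 :: real ^ 2 ^ 2) *v x + - c)" by (simp add: fun_eq_iff)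
    show "(\<lambda>x. - c + x) ` int_lattice = int_lattice"
    proof -
      have shift: "(\<lambda>y. - z + y) ` UNIV = UNIV" by (rule surjI[of _ "\<lambda>y. z + y"]) simp
      have "(\<lambda>x. - c + x) ` int_lattice = pt ` (\<lambda>y. - z + y) ` UNIV"
        unfolding range_pt[symmetric] by (simp only: image_image pt_add pt_minus z)
      then show ?thesis unfolding shift range_pt .
    qed
  qed (simp add: Q_def)
  moreover obtain k b R where "1 \<le> k" "k \<le> int w" "1 \<le> b" "k * b \<le> 2 * int w"
     "lattice_equivalent Q R" "R \<in> box_hulls (36 * k) b"
    using centred_normal_form[OF 1 2 3 4 5 6] by blast
  ultimately show ?thesis using lattice_equivalent_trans by blast
qed

section \<open>Upper bound on the number of classes\<close>

abbreviation polygon_equiv :: "nat \<Rightarrow> ((real ^ 2) set \<times> (real ^ 2) set) set" where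
  "polygon_equiv w \<equiv> {(P, Q). P \<in> symmetric_polytopes w \<and> Q \<in> symmetric_polytopes w \<and>
     lattice_equivalent P Q}"

text \<open>Every class consists of the polytopes equivalent to some hull in one of the boxes, and
  there are at most \<open>w * 2 w\<close> pairs \<open>(k, b)\<close>. Finiteness is recorded for
  the lower bound, since \<open>card\<close> of an infinite quotient would be 0.\<close>

lemma kappa_star_upper:
  assumes w: "w \<ge> 1"
  shows "finite ((symmetric_polytopes w :: (real ^ 2) set set) // polygon_equiv w)"
    and "real (kappa_star TYPE(2) w)
      \<le> 2 * real w ^ 2 *
        ((72 * real w + 1) ^ 2 * (4 * real w + 1) * exp (10 * (72 * real w) powr (1/3)))"
proof -
  let ?S = "symmetric_polytopes w :: (real ^ 2) set set"
  define M where "M = (72 * real w + 1) ^ 2 * (4 * real w + 1) * exp (10 * (72 * real w) powr (1/3))"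
  define U where "U = {u \<in> {1..int w} \<times> {1..2 * int w}. fst u * snd u \<le> 2 * int w}"
  define B where "B = (\<Union>u\<in>U. box_hulls (36 * fst u) (snd u))"
  have U: "finite U" "card U \<le> 2 * w ^ 2"
  proof -
    have sub: "U \<subseteq> {1..int w} \<times> {1..2 * int w}" by (auto simp: U_def)
    then show "finite U" by (rule finite_subset) simp
    have "card U \<le> card ({1..int w} \<times> {1..2 * int w})" using sub by (intro card_mono) simp_all
    then show "card U \<le> 2 * w ^ 2" by (simp add: card_cartesian_product power2_eq_square nat_mult_distrib)
  qed
  have box: "finite (box_hulls (36 * fst u) (snd u))"
    "real (card (box_hulls (36 * fst u) (snd u))) \<le> M" if u: "u \<in> U" for u
  proof -
    obtain k b where kb: "u = (k, b)" "1 \<le> k" "k \<le> int w" "1 \<le> b" "b \<le> 2 * int w" "k * b \<le> 2 * int w"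
      using u unfolding U_def by (cases u) auto
    have k36: "36 * k \<ge> 1" using kb(2) by simp
    show "finite (box_hulls (36 * fst u) (snd u))"
      using card_box_hulls(1)[OF k36 kb(4)] kb(1) by simp
    have "real_of_int (k * b) \<le> of_int (2 * int w)" using kb(6) by (simp only: of_int_le_iff)
    \<comment> \<open>All boxes have half-sides with product \<open>36 k * b \<le> 72 w\<close>, so
      one bound \<open>M\<close> serves for each of them.\<close>
    then have vol: "real_of_int (36 * k * b) \<le> 72 * real w" by (simp add: mult.commute)
    have kr: "1 \<le> real_of_int k" "real_of_int k \<le> real w" using kb by simp_all
    have "real_of_int b \<le> of_int (2 * int w)" using kb(5) by (simp only: of_int_le_iff)
    then have br: "1 \<le> real_of_int b" "real_of_int b \<le> 2 * real w" using kb(4) by simp_all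
    have "real (card (box_hulls (36 * k) b))
      \<le> (2 * (36 * k) + 1) ^ 2 * (2 * b + 1) * exp (10 * (36 * k * b) powr (1/3))"
      using card_box_hulls(2)[OF k36 kb(4)] by simp
    also have "\<dots> = (72 * real_of_int k + 1) ^ 2 * (2 * real_of_int b + 1) * exp (10 * real_of_int (36 * k * b) powr (1/3))"
      by simp
    also have "\<dots> \<le> M"
      unfolding M_def
      using kr br vol by (intro mult_mono power_mono) (auto intro!: powr_mono2 mult_nonneg_nonneg)
    finally show "real (card (box_hulls (36 * fst u) (snd u))) \<le> M" using kb(1) by simp
  qed
  have finB: "finite B" unfolding B_def using U box by blast
  \<comment> \<open>A hull \<open>Q\<close> from a box may have another number of lattice points;
    only the values of \<open>h\<close> are restricted to
    \<open>symmetric_polytopes w\<close>.\<close>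
  define h where "h Q = {R \<in> ?S. lattice_equivalent Q R}" for Q :: "(real ^ 2) set"
  have sub: "?S // polygon_equiv w \<subseteq> h ` B"
  proof
    fix X assume "X \<in> ?S // polygon_equiv w"
    then obtain P where P: "P \<in> ?S" "X = polygon_equiv w `` {P}" by (rule quotientE)
    obtain k b Q where Q: "1 \<le> k" "k \<le> int w" "1 \<le> b" "k * b \<le> 2 * int w"
      "lattice_equivalent P Q" "Q \<in> box_hulls (36 * k) b"
      using equivalent_to_box_hull[OF P(1)] by blast
    have "1 * b \<le> k * b" using Q by (intro mult_right_mono) auto
    then have "b \<le> 2 * int w" using Q(4) by linarith
    then have "(k, b) \<in> U" using Q by (simp add: U_def)
    then have "Q \<in> B" using Q(6) unfolding B_def by force
    moreover have "lattice_equivalent Q R \<longleftrightarrow> lattice_equivalent P R" for R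
      using Q(5) lattice_equivalent_sym lattice_equivalent_trans by blast
    then have "X = h Q" unfolding P(2) h_def using P(1) by auto
    ultimately show "X \<in> h ` B" by blast
  qed
  then show "finite (?S // polygon_equiv w)" using finB finite_subset by blast
  have "kappa_star TYPE(2) w \<le> card (h ` B)"
    unfolding kappa_star_def using sub finB by (intro card_mono) auto
  also have "\<dots> \<le> card B" using finB by (rule card_image_le)
  also have "\<dots> \<le> (\<Sum>u\<in>U. card (box_hulls (36 * fst u) (snd u)))"
    unfolding B_def by (rule card_UN_le[OF U(1)])
  finally have "real (kappa_star TYPE(2) w) \<le> real (\<Sum>u\<in>U. card (box_hulls (36 * fst u) (snd u)))"
    by (simp only: of_nat_le_iff)
  also have "\<dots> \<le> (\<Sum>u\<in>U. M)"
    using box(2) by (simp only: of_nat_sum) (rule sum_mono)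
  also have "\<dots> = real (card U) * M" by simp
  also have "\<dots> \<le> real (2 * w ^ 2) * M"
    using U(2) by (intro mult_right_mono) (simp_all only: of_nat_le_iff, simp add: M_def)
  finally show "real (kappa_star TYPE(2) w)
      \<le> 2 * real w ^ 2 *
        ((72 * real w + 1) ^ 2 * (4 * real w + 1) * exp (10 * (72 * real w) powr (1/3)))"
    unfolding M_def by simp
qed

subsection \<open>A large family of polygons with the same number of lattice points\<close>

text \<open>A parabola, pushed down by \<open>1\<close> over \<open>S\<close>. As the second difference of the parabola is
  \<open>- 2\<close>, this stays concave for every \<open>S\<close>. Pushing down the end point by \<open>r\<close>
  adjusts the number of lattice points.\<close>

definition parab :: "int \<Rightarrow> int \<Rightarrow> int \<Rightarrow> int set \<Rightarrow> int \<Rightarrow> int" where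
  "parab n H r S x = H - x\<^sup>2 - (if x = n then r else if x \<in> S then 1 else 0)"

text \<open>The lower boundary over \<open>x\<close> is the negative of the upper boundary over
  \<open>- x\<close>, so symmetry about the origin is built in.\<close>

definition parab_region :: "int \<Rightarrow> int \<Rightarrow> int \<Rightarrow> int set \<Rightarrow> (int \<times> int) set" where
  "parab_region n H r S = (SIGMA x:{- n..n}. {- parab n H r S (- x)..parab n H r S x})"

text \<open>The lower bound on \<open>H\<close> keeps the upper boundary at height at least 1, also
  at the lowered end point; hence the region contains the origin and both unit vectors.\<close>

locale parab_params =
  fixes n H r :: int and S :: "int set"
  assumes n: "1 \<le> n" and r: "0 \<le> r" and H: "n\<^sup>2 + r + 1 \<le> H" and S: "S \<subseteq> {1..<n}"
begin

abbreviation "g \<equiv> parab n H r S"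
abbreviation "T \<equiv> parab_region n H r S"
abbreviation "P \<equiv> convex hull (pt ` T)"

lemma finite_T: "finite T"
  by (simp add: parab_region_def)

lemma mem_T: "z \<in> T \<longleftrightarrow> \<bar>fst z\<bar> \<le> n \<and> - g (- fst z) \<le> snd z \<and> snd z \<le> g (fst z)"
  by (cases z) (auto simp: parab_region_def)

lemma uminus_T: "- z \<in> T \<longleftrightarrow> z \<in> T"
  by (auto simp: mem_T)

lemma g_ge_1:
  assumes "\<bar>x\<bar> \<le> n"
  shows "1 \<le> g x"
proof -
  have "x\<^sup>2 \<le> n\<^sup>2" using assms by (simp add: abs_le_square_iff[symmetric])
  \<comment> \<open>Over \<open>S\<close> the abscissa is below \<open>n\<close>, and the gap
    between the squares absorbs the lowering by 1.\<close>
  moreover have "x\<^sup>2 + 1 \<le> n\<^sup>2" if "x \<in> S"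
  proof -
    have "0 \<le> x" "x + 1 \<le> n" "1 \<le> x" using that S by auto
    then have "(x + 1)\<^sup>2 \<le> n\<^sup>2" by (intro power_mono) auto
    then show ?thesis using \<open>1 \<le> x\<close> by (simp add: power2_eq_square algebra_simps)
  qed
  ultimately show ?thesis using H r unfolding parab_def by auto
qed

text \<open>The tangent of the parabola at \<open>x\<close> clears every other integer abscissa by
  \<open>(t - x)\<^sup>2 \<ge> 1\<close>, which absorbs a lowering by 1 at \<open>x\<close>. At
  \<open>x = n\<close> all other points lie to the left, so steepening the slope by \<open>r\<close>
  makes up for the lowering by \<open>r\<close>.\<close>

lemma g_tangent:
  assumes "\<bar>x\<bar> \<le> n" "\<bar>t\<bar> \<le> n"
  shows "g t \<le> g x + (- 2 * x - (if x = n then r else 0)) * (t - x)"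
proof (cases "t = x")
  case False
  define \<delta> where "\<delta> y = (if y = n then r else if y \<in> S then 1 else 0)" for y
  have g: "g y = H - y\<^sup>2 - \<delta> y" for y by (simp add: parab_def \<delta>_def)
  have eq: "g x + (- 2 * x) * (t - x) = g t + (t - x)\<^sup>2 - \<delta> x + \<delta> t"
    by (simp add: g power2_eq_square algebra_simps)
  have d: "1 \<le> (t - x)\<^sup>2" "0 \<le> \<delta> t"
    using False r by (simp_all add: int_one_le_iff_zero_less \<delta>_def)
  show ?thesis
  proof (cases "x = n")
    case True
    then have "1 \<le> x - t" using False assms by auto
    then have "r * 1 \<le> r * (x - t)" using r by (intro mult_left_mono) auto
    moreover have "(- 2 * x - r) * (t - x) = (- 2 * x) * (t - x) + r * (x - t)"
      by (simp add: algebra_simps)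
    moreover have "\<delta> x = r" using True by (simp add: \<delta>_def)
    ultimately have "g t \<le> g x + (- 2 * x - r) * (t - x)" using eq d by linarith
    with True show ?thesis by simp
  next
    case False
    then have "\<delta> x \<le> 1" by (simp add: \<delta>_def)
    then have "g t \<le> g x + (- 2 * x) * (t - x)" using eq d by linarith
    with False show ?thesis by simp
  qed
qed simp

lemma hull_halfplane:
  assumes "\<And>t. t \<in> T \<Longrightarrow> A * fst t + B * snd t \<le> C" and z: "pt z \<in> P"
  shows "A * fst z + B * snd z \<le> C"
proof -
  have ineq: "pt (A, B) \<bullet> pt t \<le> real_of_int C \<longleftrightarrow> A * fst t + B * snd t \<le> C" for t
  proof -
    have "pt (A, B) \<bullet> pt t = real_of_int (A * fst t + B * snd t)" by (simp add: inner_vec2)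
    then show ?thesis by (simp only: of_int_le_iff)
  qed
  have "P \<subseteq> {x. pt (A, B) \<bullet> x \<le> real_of_int C}"
    using assms(1) by (intro hull_minimal convex_halfspace_le) (auto simp: ineq)
  then show ?thesis using z ineq by blast
qed

lemma uminus_P: "x \<in> P \<Longrightarrow> - x \<in> P"
proof -
  assume "x \<in> P"
  then have "- x \<in> uminus ` P" by blast
  also have "uminus ` P = convex hull (uminus ` pt ` T)"
    by (rule convex_hull_linear_image) (simp add: linear_iff)
  also have "uminus ` pt ` T = pt ` uminus ` T" by (simp add: image_image pt_minus)
  also have "uminus ` T = T"
  proof (intro equalityI subsetI)
    fix z assume "z \<in> T"
    then show "z \<in> uminus ` T" using uminus_T by (intro image_eqI[of _ _ "- z"]) simp_all
  qed (use uminus_T in auto)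
  finally show ?thesis .
qed

text \<open>The lines of \<open>g_tangent\<close> cut off everything above the boundary at each
  integer abscissa, and symmetry handles the lower side; so the hull gains no lattice
  points.\<close>

lemma lat_P: "lat P = T"
proof
  show "T \<subseteq> lat P" by (auto simp: lat_def intro: hull_inc)
  have "1 * fst t + 0 * snd t \<le> n" if "t \<in> T" for t
    using that by (auto simp: mem_T abs_le_iff)
  from hull_halfplane[OF this] have fst_le: "fst z \<le> n" if "pt z \<in> P" for z
    using that by simp
  have abs_le: "\<bar>fst z\<bar> \<le> n" if "pt z \<in> P" for z
    using fst_le[OF that] fst_le[of "- z"] uminus_P[OF that] by (simp add: pt_minus)
  have snd_le: "snd z \<le> g (fst z)" if "pt z \<in> P" for z
  proof -
    define m where "m = - 2 * fst z - (if fst z = n then r else 0)"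
    have "- m * fst t + 1 * snd t \<le> g (fst z) - m * fst z" if "t \<in> T" for t
      using g_tangent[OF abs_le[OF \<open>pt z \<in> P\<close>], of "fst t"] that
      unfolding mem_T m_def[symmetric] by (simp add: algebra_simps)
    from hull_halfplane[OF this that] show ?thesis by simp
  qed
  show "lat P \<subseteq> T"
  proof
    fix z assume "z \<in> lat P"
    then have z: "pt z \<in> P" by (simp add: lat_def)
    have "snd (- z) \<le> g (fst (- z))"
      using uminus_P[OF z] by (intro snd_le) (simp add: pt_minus)
    then show "z \<in> T" using abs_le[OF z] snd_le[OF z] by (simp add: mem_T)
  qed
qed

lemma basis_T: "(0, 0) \<in> T" "(1, 0) \<in> T" "(0, 1) \<in> T"
  using n g_ge_1[of 0] g_ge_1[of 1] g_ge_1[of "-1"] by (auto simp: mem_T)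

lemma interior_P: "interior P \<noteq> {}"
proof -
  have "insert 0 Basis \<subseteq> pt ` T"
  proof -
    have "Basis = {axis 1 1, axis 2 (1::real) :: real ^ 2}"
      by (auto simp: Basis_vec_def UNIV_2)
    moreover have "axis 1 1 = pt (1, 0)" "axis 2 1 = pt (0, 1)" "0 = pt (0, 0)"
      by (simp_all add: vec2_eq_iff axis_def)
    ultimately show ?thesis using basis_T by (metis imageI insert_subset empty_subsetI)
  qed
  then have "interior (convex hull (insert 0 Basis)) \<subseteq> interior P"
    by (intro interior_mono hull_mono)
  then show ?thesis using interior_std_simplex_nonempty by blast
qed

text \<open>Column \<open>x\<close> has \<open>g x + g (- x) + 1\<close> points. Only the sum
  \<open>r + card S\<close> enters, so \<open>r\<close> can compensate for the choice of
  \<open>S\<close>.\<close>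

lemma card_T: "int (card T) = (2 * n + 1) * (2 * H + 1) - 2 * (\<Sum>x\<in>{- n..n}. x\<^sup>2) - 2 * (r + int (card S))"
proof -
  have reflect: "(\<Sum>x\<in>{- n..n}. f (- x)) = (\<Sum>x\<in>{- n..n}. f x)" for f :: "int \<Rightarrow> int"
    by (rule sum.reindex_bij_witness[of _ uminus uminus]) auto
  have "(\<Sum>x\<in>{- n..n}. if x = n then r else if x \<in> S then 1 else 0)
    = (\<Sum>x\<in>{- n..n}. (if x = n then r else 0) + (if x \<in> S then 1 else 0))"
    using S by (intro sum.cong) auto
  also have "\<dots> = r + int (card ({- n..n} \<inter> S))"
    using n by (simp add: sum.distrib sum.If_cases)
  also have "{- n..n} \<inter> S = S" using S by auto
  finally have g_sum: "(\<Sum>x\<in>{- n..n}. g x) = (2 * n + 1) * H - (\<Sum>x\<in>{- n..n}. x\<^sup>2) - (r + int (card S))"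
    using n by (simp add: parab_def sum_subtractf)
  have "int (card T) = (\<Sum>x\<in>{- n..n}. int (nat (g x + g (- x) + 1)))"
    unfolding parab_region_def by (simp add: algebra_simps)
  also have "\<dots> = (\<Sum>x\<in>{- n..n}. g x + g (- x) + 1)"
  proof (rule sum.cong)
    fix x assume "x \<in> {- n..n}"
    then have "\<bar>x\<bar> \<le> n" "\<bar>- x\<bar> \<le> n" by auto
    then show "int (nat (g x + g (- x) + 1)) = g x + g (- x) + 1"
      using g_ge_1[of x] g_ge_1[of "- x"] by simp
  qed simp
  also have "\<dots> = 2 * (\<Sum>x\<in>{- n..n}. g x) + (2 * n + 1)"
    using n by (simp add: sum.distrib reflect)
  finally show ?thesis unfolding g_sum by (simp add: algebra_simps)
qed

lemma P_symmetric_polytope: "P \<in> symmetric_polytopes (card T)"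
proof -
  have "(\<lambda>x. 2 *\<^sub>R 0 - x) ` P = P"
  proof (intro equalityI subsetI)
    fix x assume "x \<in> P"
    then show "x \<in> (\<lambda>x. 2 *\<^sub>R 0 - x) ` P"
      using uminus_P by (intro image_eqI[of _ _ "- x"]) simp_all
  qed (use uminus_P in auto)
  moreover have "(0 :: real ^ 2) \<in> int_lattice" by (simp add: int_lattice_def)
  ultimately show ?thesis
    unfolding symmetric_polytopes_def centrally_symmetric_def
    using lattice_polytope_hull[OF finite_T] interior_P
    by (intro CollectI conjI bexI[of _ 0]) (simp_all add: lattice_point_count_lat lat_P)
qed

end

text \<open>For \<open>1 \<le> s < n\<close> the parabola point \<open>(s, H - s\<^sup>2)\<close>
  belongs to the region exactly when \<open>s \<notin> S\<close>.\<close>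

lemma parab_region_inj:
  assumes 1: "parab_params n H r S" and 2: "parab_params n H r' S'"
    and eq: "parab_region n H r S = parab_region n H r' S'"
  shows "S \<subseteq> S'"
proof (rule subsetI, rule ccontr)
  interpret A: parab_params n H r S by fact
  interpret B: parab_params n H r' S' by fact
  fix s assume s: "s \<in> S" "s \<notin> S'"
  then have "1 \<le> s" "s < n" using A.S by auto
  then have "(s, H - s\<^sup>2) \<in> parab_region n H r' S'"
    using s B.g_ge_1[of s] B.g_ge_1[of "- s"] unfolding B.mem_T by (simp add: parab_def)
  then have "(s, H - s\<^sup>2) \<in> parab_region n H r S" using eq by simp
  then show False using s \<open>s < n\<close> unfolding A.mem_T by (simp add: parab_def)
qed

text \<open>Each polygon equivalent to a fixed \<open>P\<close> is a preimage of \<open>P\<close> under an affine map, which is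
  determined by the images in \<open>P\<close> of the three base points.\<close>

lemma card_family_le:
  fixes F :: "(real ^ 2) set set"
  assumes fin: "finite ((symmetric_polytopes w :: (real ^ 2) set set) // polygon_equiv w)"
    and F: "F \<subseteq> symmetric_polytopes w"
    and basis: "\<And>P. P \<in> F \<Longrightarrow> {(0, 0), (1, 0), (0, 1)} \<subseteq> lat P"
  shows "card F \<le> kappa_star TYPE(2) w * w ^ 3"
proof -
  let ?S = "symmetric_polytopes w :: (real ^ 2) set set"
  have equiv: "equiv ?S (polygon_equiv w)" by (rule equiv_lattice_equivalent)
  have class_le: "finite (F \<inter> X) \<and> card (F \<inter> X) \<le> w ^ 3" if X: "X \<in> ?S // polygon_equiv w" for X
  proof (cases "F \<inter> X = {}")
    case False
    then obtain P where P: "P \<in> F" "P \<in> X" by blast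
    have PS: "P \<in> ?S" using P F by blast
    then have latP: "finite (P \<inter> int_lattice)" "card (P \<inter> int_lattice) = w"
      by (auto simp: symmetric_polytopes_def lattice_point_count_def pt_lat[symmetric]
          intro!: finite_lat bounded_lattice_polytope)
    have "\<exists>\<tau>. (\<exists>A b. invertible A \<and> \<tau> = (\<lambda>x. A *v x + b)) \<and> \<tau> ` int_lattice = int_lattice \<and> \<tau> ` Q = P"
      if "Q \<in> F \<inter> X" for Q
    proof -
      have "(Q, P) \<in> polygon_equiv w"
        using that P(2) quotient_eq_iff[OF equiv X X, of Q P] by blast
      then show ?thesis unfolding lattice_equivalent_def affine_transformation_def by blast
    qed
    then obtain \<tau> where \<tau>: "\<And>Q. Q \<in> F \<inter> X \<Longrightarrow>
       (\<exists>A b. invertible A \<and> \<tau> Q = (\<lambda>x. A *v x + b)) \<and> \<tau> Q ` int_lattice = int_lattice \<and> \<tau> Q ` Q = P"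
      by metis
    \<comment> \<open>The base points lie in \<open>Q\<close>, so \<open>\<phi> Q\<close> is one of
      \<open>w ^ 3\<close> triples of lattice points of \<open>P\<close>.\<close>
    define \<phi> where "\<phi> Q = (\<tau> Q (pt (0, 0)), \<tau> Q (pt (1, 0)), \<tau> Q (pt (0, 1)))" for Q
    let ?L = "P \<inter> int_lattice"
    have "\<phi> ` (F \<inter> X) \<subseteq> ?L \<times> ?L \<times> ?L"
    proof (rule image_subsetI)
      fix Q assume Q: "Q \<in> F \<inter> X"
      have "\<tau> Q (pt z) \<in> ?L" if "z \<in> lat Q" for z
        using that \<tau>[OF Q] range_pt unfolding lat_def by blast
      then show "\<phi> Q \<in> ?L \<times> ?L \<times> ?L" using basis[of Q] Q unfolding \<phi>_def by (simp del: pt_zero)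
    qed
    moreover have "inj_on \<phi> (F \<inter> X)"
    proof (rule inj_onI)
      fix Q R assume QR: "Q \<in> F \<inter> X" "R \<in> F \<inter> X" "\<phi> Q = \<phi> R"
      obtain A b where A: "invertible A" "\<tau> Q = (\<lambda>x. A *v x + b)" using \<tau>[OF QR(1)] by blast
      obtain B c where B: "invertible B" "\<tau> R = (\<lambda>x. B *v x + c)" using \<tau>[OF QR(2)] by blast
      have bc: "b = c" using QR(3) by (simp add: \<phi>_def A B)
      have cols: "A *v pt (1, 0) = B *v pt (1, 0)" "A *v pt (0, 1) = B *v pt (0, 1)"
        using QR(3) by (simp_all add: \<phi>_def A B bc)
      have dec: "x $ 1 *\<^sub>R pt (1, 0) + x $ 2 *\<^sub>R pt (0, 1) = x" for x :: "real ^ 2"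
        by (simp add: vec2_eq_iff)
      have "A *v (x $ 1 *\<^sub>R pt (1, 0) + x $ 2 *\<^sub>R pt (0, 1)) =
          B *v (x $ 1 *\<^sub>R pt (1, 0) + x $ 2 *\<^sub>R pt (0, 1))" for x :: "real ^ 2"
        by (simp only: matrix_vector_right_distrib matrix_vector_mult_scaleR cols)
      then have "A *v x = B *v x" for x unfolding dec .
      then have same: "\<tau> Q = \<tau> R" by (simp add: A B bc)
      have "inj (\<tau> Q)" using inj_matrix_vector_mult[OF A(1)] unfolding A(2) by (simp add: inj_def)
      moreover have "\<tau> Q ` Q = \<tau> Q ` R" using \<tau>[OF QR(1)] \<tau>[OF QR(2)] same by simp
      ultimately show "Q = R" by (simp add: inj_image_eq_iff)
    qed
    moreover have "finite (?L \<times> ?L \<times> ?L)" using latP by simp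
    ultimately have "finite (F \<inter> X)" "card (F \<inter> X) \<le> card (?L \<times> ?L \<times> ?L)"
      by (meson finite_imageD finite_subset, meson card_inj_on_le)
    then show ?thesis using latP by (simp add: card_cartesian_product power3_eq_cube)
  qed simp
  have "F \<subseteq> (\<Union>X\<in>?S // polygon_equiv w. F \<inter> X)"
    using F Union_quotient[OF equiv] by blast
  moreover have "finite (\<Union>X\<in>?S // polygon_equiv w. F \<inter> X)"
    by (rule finite_UN_I[OF fin]) (use class_le in blast)
  ultimately have "card F \<le> card (\<Union>X\<in>?S // polygon_equiv w. F \<inter> X)"
    by (rule card_mono[rotated])
  also have "\<dots> \<le> (\<Sum>X\<in>?S // polygon_equiv w. card (F \<inter> X))"
    by (rule card_UN_le[OF fin])
  also have "\<dots> \<le> (\<Sum>X\<in>?S // polygon_equiv w. w ^ 3)"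
    using class_le by (intro sum_mono) blast
  finally show ?thesis by (simp add: kappa_star_def)
qed

text \<open>With \<open>N = 2 n + 1\<close>, the count in \<open>card_T\<close> equals
  \<open>w\<close> exactly when \<open>R = r + card S\<close> satisfies
  \<open>N * H - R = A\<close>. A fixed \<open>H\<close> leaves one value of \<open>R\<close>, and
  \<open>r = R - card S\<close> realises it for every \<open>S\<close>.\<close>

lemma kappa_star_lower:
  fixes n w :: nat
  assumes "odd w" and n: "1 \<le> n" and w: "54 * n ^ 3 \<le> w"
  shows "2 ^ (n - 1) \<le> kappa_star TYPE(2) w * w ^ 3"
proof -
  define N where "N = 2 * int n + 1"
  define q where "q = (\<Sum>x\<in>{- int n..int n}. x\<^sup>2)"
  define A where "A = (int w + 2 * q - N) div 2"
  \<comment> \<open>The summand 2 places \<open>R\<close> in \<open>N < R \<le> 2 * N\<close>: large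
    enough to subtract any \<open>card S < N\<close>, small enough for the height condition on
    \<open>H\<close>.\<close>
  define H where "H = A div N + 2"
  define R where "R = N * H - A"
  \<comment> \<open>Both \<open>w\<close> and \<open>N\<close> are odd, so the division by 2 is
    exact.\<close>
  have "even (int w + 2 * q - N)" using \<open>odd w\<close> by (simp add: N_def)
  then have A: "2 * A = int w + 2 * q - N" by (simp add: A_def)
  have N: "0 < N" "N \<le> 3 * int n" using n by (simp_all add: N_def)
  have "R = 2 * N - A mod N"
    unfolding R_def H_def by (simp add: algebra_simps minus_mult_div_eq_mod[symmetric])
  moreover have "0 \<le> A mod N" "A mod N < N" using N by simp_all
  ultimately have R: "N < R" "R \<le> 2 * N" by linarith+
  have nn: "int n \<le> (int n)\<^sup>2" using n by (simp add: power2_eq_square)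
  \<comment> \<open>The height condition reduces to \<open>N (n\<^sup>2 + 2 N - 1) \<le> A\<close>.
    By \<open>N \<le> 3 n\<close> the left side is at most \<open>21 n\<^sup>3\<close>, and twice 21
    is below 54.\<close>
  have "(int n)\<^sup>2 + 2 * N \<le> 7 * (int n)\<^sup>2" using N nn by linarith
  then have "N * ((int n)\<^sup>2 + 2 * N) \<le> (3 * int n) * (7 * (int n)\<^sup>2)"
    using N by (intro mult_mono) auto
  moreover have "54 * int n ^ 3 \<le> int w"
  proof -
    have "int (54 * n ^ 3) \<le> int w" using w by (simp only: of_nat_le_iff)
    then show ?thesis by simp
  qed
  moreover have "0 \<le> q" unfolding q_def by (intro sum_nonneg) simp
  moreover have "0 \<le> int n ^ 3" by simp
  moreover have "(3 * int n) * (7 * (int n)\<^sup>2) = 21 * int n ^ 3" by (simp add: power2_eq_square power3_eq_cube)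
  moreover have "N * ((int n)\<^sup>2 + 2 * N - 1) = N * ((int n)\<^sup>2 + 2 * N) - N" by (simp add: algebra_simps)
  ultimately have "N * ((int n)\<^sup>2 + 2 * N - 1) \<le> A" using A N(1) by linarith
  then have "N * ((int n)\<^sup>2 + 2 * N - 1) div N \<le> A div N"
    using N(1) by (rule zdiv_mono1)
  then have H: "(int n)\<^sup>2 + 2 * N + 1 \<le> H" using N(1) by (simp add: H_def)
  have cS: "int (card S) < N" if "S \<subseteq> {1..<int n}" for S
  proof -
    have "card S \<le> card {1..<int n}" using that by (intro card_mono) simp_all
    then show ?thesis using n by (simp add: N_def)
  qed
  define T where "T S = parab_region (int n) H (R - int (card S)) S" for S
  have par: "parab_params (int n) H (R - int (card S)) S" if "S \<subseteq> {1..<int n}" for S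
    using n R H cS[OF that] that by unfold_locales auto
  have cT: "card (T S) = w" if "S \<subseteq> {1..<int n}" for S
  proof -
    have "int (card (T S)) = N * (2 * H + 1) - 2 * q - 2 * R"
      unfolding T_def parab_params.card_T[OF par[OF that]] N_def q_def by simp
    also have "\<dots> = int w" using A by (simp add: R_def algebra_simps)
    finally show ?thesis by simp
  qed
  define F where "F = (\<lambda>S. convex hull (pt ` T S)) ` Pow {1..<int n}"
  have lat: "lat (convex hull (pt ` T S)) = T S" if "S \<subseteq> {1..<int n}" for S
    unfolding T_def by (rule parab_params.lat_P[OF par[OF that]])
  have "inj_on (\<lambda>S. convex hull (pt ` T S)) (Pow {1..<int n})"
  proof (rule inj_onI)
    fix S S' assume S: "S \<in> Pow {1..<int n}" "S' \<in> Pow {1..<int n}"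
      and "convex hull (pt ` T S) = convex hull (pt ` T S')"
    then have "T S = T S'" using lat by (metis PowD)
    then show "S = S'"
      using parab_region_inj[OF par par] S unfolding T_def by (metis PowD subset_antisym)
  qed
  then have "card F = 2 ^ (n - 1)"
    unfolding F_def by (simp add: card_image card_Pow nat_diff_distrib)
  moreover have "F \<subseteq> symmetric_polytopes w"
    unfolding F_def
  proof (rule image_subsetI)
    fix S assume "S \<in> Pow {1..<int n}"
    then have S: "S \<subseteq> {1..<int n}" by simp
    show "convex hull (pt ` T S) \<in> symmetric_polytopes w"
      using parab_params.P_symmetric_polytope[OF par[OF S]] cT[OF S] unfolding T_def by simp
  qed
  moreover have "{(0, 0), (1, 0), (0, 1)} \<subseteq> lat P" if "P \<in> F" for P
  proof -
    obtain S where S: "S \<subseteq> {1..<int n}" "P = convex hull (pt ` T S)"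
      using \<open>P \<in> F\<close> unfolding F_def by blast
    show ?thesis
      unfolding S(2) lat[OF S(1)] using parab_params.basis_T[OF par[OF S(1)]] by (simp add: T_def)
  qed
  moreover have "w \<ge> 1" using \<open>odd w\<close> by (cases w) auto
  ultimately show ?thesis
    using card_family_le[OF kappa_star_upper(1)] by metis
qed

section \<open>Asymptotic comparison with \<open>w powr (1/3)\<close>\<close>

theorem theorem3:
  "\<exists>c1 c2 :: real. \<exists>w0 :: nat. c1 > 0 \<and> c2 > 0 \<and> w0 > 0 \<and>
     (\<forall>w. odd w \<and> w \<ge> w0 \<longrightarrow>
        c1 * real w powr (1/3) \<le> ln (real (kappa_star TYPE(2) w)) \<and>
        ln (real (kappa_star TYPE(2) w)) \<le> c2 * real w powr (1/3))"
proof -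
  have "eventually (\<lambda>x::real. ln (2 * x ^ 2 * (72 * x + 1) ^ 2 * (4 * x + 1)) \<le> x powr (1/3)) at_top"
    by real_asymp
  \<comment> \<open>The factor \<open>w ^ 3\<close> costs \<open>3 * ln w\<close> and the rounding
    of \<open>n\<close> costs 1; both are paid for by lowering the constant from
    \<open>1 / 8\<close> to \<open>1 / 16\<close>.\<close>
  moreover have "eventually (\<lambda>x::real. x powr (1/3) / 16 + 3 * ln x + 1 \<le> x powr (1/3) / 8) at_top"
    by real_asymp
  moreover have "eventually (\<lambda>x::real. 8 \<le> x powr (1/3)) at_top"
    by real_asymp
  ultimately have "eventually (\<lambda>x::real.
      ln (2 * x ^ 2 * (72 * x + 1) ^ 2 * (4 * x + 1)) \<le> x powr (1/3) \<and>
      x powr (1/3) / 16 + 3 * ln x + 1 \<le> x powr (1/3) / 8 \<and> 8 \<le> x powr (1/3)) at_top"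
    by eventually_elim simp
  then obtain x0 where x0: "\<And>x::real. x \<ge> x0 \<Longrightarrow>
      ln (2 * x ^ 2 * (72 * x + 1) ^ 2 * (4 * x + 1)) \<le> x powr (1/3) \<and>
      x powr (1/3) / 16 + 3 * ln x + 1 \<le> x powr (1/3) / 8 \<and> 8 \<le> x powr (1/3)"
    unfolding eventually_at_top_linorder by blast
  define w0 where "w0 = nat \<lceil>max x0 1\<rceil>"
  have bounds: "1 / 16 * real w powr (1/3) \<le> ln (real (kappa_star TYPE(2) w)) \<and>
      ln (real (kappa_star TYPE(2) w)) \<le> 51 * real w powr (1/3)"
    if w: "odd w" "w \<ge> w0" for w
  proof -
    define y where "y = real w powr (1/3)"
    define k where "k = real (kappa_star TYPE(2) w)"
    have "max x0 1 \<le> real w" using w(2) unfolding w0_def by linarith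
    then have x: "x0 \<le> real w" and w1: "1 \<le> real w" by simp_all
    note as = x0[OF x, folded y_def]
    have y3: "y ^ 3 = real w"
    proof -
      have "y powr real 3 = real w" using w1 unfolding y_def powr_powr by simp
      moreover have "y > 0" using as by simp
      ultimately show ?thesis using powr_realpow[of y 3] by simp
    qed
    \<comment> \<open>\<open>n\<^sup>3 \<le> w / 64\<close> is within the bound
      \<open>54 * n ^ 3 \<le> w\<close> of \<open>kappa_star_lower\<close>, and
      \<open>y \<ge> 8\<close> ensures \<open>n \<ge> 1\<close>.\<close>
    define n where "n = nat \<lfloor>y / 4\<rfloor>"
    have n: "1 \<le> n" "real n \<le> y / 4" "y / 4 - 1 \<le> real n"
      using as unfolding n_def by linarith+
    have "real n ^ 3 \<le> (y / 4) ^ 3" using n(2) by (intro power_mono) auto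
    then have "real (64 * n ^ 3) \<le> real w" by (simp add: power_divide y3)
    then have "54 * n ^ 3 \<le> w" by linarith
    from kappa_star_lower[OF w(1) n(1) this]
    have "real (2 ^ (n - 1)) \<le> real (kappa_star TYPE(2) w * w ^ 3)" by (simp only: of_nat_le_iff)
    then have low: "2 ^ (n - 1) \<le> k * real w ^ 3" by (simp add: k_def)
    moreover have "(0::real) < 2 ^ (n - 1)" by simp
    ultimately have "0 < k * real w ^ 3" by linarith
    \<comment> \<open>The lower bound shows that there is at least one class, so \<open>ln k\<close>
      is not the default value at 0.\<close>
    then have k: "k > 0" using w1 by (simp add: zero_less_mult_iff)
    have "ln (2 ^ (n - 1)) \<le> ln (k * real w ^ 3)"
      using low k w1 by (subst ln_le_cancel_iff) auto
    then have "real (n - 1) * ln 2 \<le> ln k + 3 * ln (real w)"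
      using k w1 by (simp add: ln_mult ln_realpow)
    moreover have "real (n - 1) * (1 / 2) \<le> real (n - 1) * ln 2"
      using ln2_ge_two_thirds by (intro mult_left_mono) auto
    moreover have "real (n - 1) = real n - 1" using n(1) by simp
    ultimately have lower: "1 / 16 * y \<le> ln k"
      using n(3) as by linarith
    \<comment> \<open>\<open>72 \<le> 5 ^ 3\<close> bounds the exponent by \<open>50 * y\<close>;
      the polynomial factors add one more \<open>y\<close>, which gives 51.\<close>
    have "(72 * real w) powr (1/3) \<le> (125 * real w) powr (1/3)"
      by (intro powr_mono2) auto
    also have "(125 * real w) powr (1/3) = (5 powr 3) powr (1/3) * y"
      by (simp add: powr_mult y_def)
    also have "\<dots> = 5 * y" unfolding powr_powr by simp
    finally have 5: "(72 * real w) powr (1/3) \<le> 5 * y" .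
    have "k \<le> 2 * real w ^ 2 * ((72 * real w + 1) ^ 2 * (4 * real w + 1) * exp (10 * (72 * real w) powr (1/3)))"
      unfolding k_def using w1 by (intro kappa_star_upper(2)) simp
    also have "\<dots> \<le> 2 * real w ^ 2 * ((72 * real w + 1) ^ 2 * (4 * real w + 1) * exp (50 * y))"
      using 5 by (intro mult_left_mono) auto
    also have "\<dots> = (2 * real w ^ 2 * (72 * real w + 1) ^ 2 * (4 * real w + 1)) * exp (50 * y)"
      by simp
    finally have k_le: "k \<le> (2 * real w ^ 2 * (72 * real w + 1) ^ 2 * (4 * real w + 1)) * exp (50 * y)" .
    then have "ln k \<le> ln ((2 * real w ^ 2 * (72 * real w + 1) ^ 2 * (4 * real w + 1)) * exp (50 * y))"
      by (rule iffD2[OF ln_le_cancel_iff[OF k less_le_trans[OF k k_le]]])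
    also have "\<dots> = ln (2 * real w ^ 2 * (72 * real w + 1) ^ 2 * (4 * real w + 1)) + 50 * y"
      using w1 by (subst ln_mult) auto
    also have "\<dots> \<le> 51 * y" using as by simp
    finally show ?thesis using lower unfolding k_def y_def by blast
  qed
  have "w0 > 0" by (simp add: w0_def)
  with bounds show ?thesis
    by (intro exI[of _ "1 / 16"] exI[of _ 51] exI[of _ w0]) simp
qed

end
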